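(* For $n,k\ge 0$ let $w_{n,k}$ be the number of weakly graded $(\mathbf{3+1})$-avoiding posets on the vertex set $[n]$ of height $k$, and let $w_n=\sum_k w_{n,k}$. Let $\Psi(x)=\sum_{m,n\ge 0}\frac{2^{mn}x^{m+n}}{m!\,n!}$. Then $$\sum_{n,k} w_{n,k}\frac{x^n}{n!}t^k = 1+(e^x-1)t+(e^{-x}\Psi(x)-e^x)t^2 + t^3\,\frac{e^{3x}+e^{3x}t-e^x\big(2e^x+(1+2e^x-e^{2x})t\big)\Psi(x)-\big((1-3e^x+e^{2x})+(e^x-2)t\big)\Psi(x)^2}{e^x(e^x+te^x+t^2)+\big((1-3e^x+e^{2x})t+(e^x-2)t^2\big)\Psi(x)},$$ and $$\sum_{n\ge 0} w_n\frac{x^n}{n!} = (e^{-x}-1)\Psi(x)+\frac{2e^{3x}+e^{2x}(e^x-2)\Psi(x)}{e^x(2e^x+1)+(e^{2x}-2e^x-1)\Psi(x)}.$$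
   Context: All posets are finite; a poset on $[n]=\{1,\dots,n\}$ is a partial order on this labeled set, and distinct order relations give distinct posets. A poset $P$ is weakly graded if there is a function $\operatorname{rk}:P\to\mathbb{N}$ such that $\operatorname{rk}(b)=\operatorname{rk}(a)+1$ whenever $b$ covers $a$, and such that the minimum value of $\operatorname{rk}$ on each connected component of $P$ is $0$. The height of a poset is the number of elements in a longest chain (the empty poset has height $0$). A poset is $(\mathbf{3+1})$-avoiding if there are no four elements $x,y,z,w$ with $x<y<z$ and $w$ incomparable to each of $x,y,z$. *)

theory Defs
  imports Complex_Main "HOL-Computational_Algebra.Formal_Power_Series"
begin

text \<open>
  A poset on a finite set \<open>A\<close> is its reflexive order relation \<open>r\<close> with \<open>partial_order_on A r\<close>;
  this includes \<open>r \<subseteq> A \<times> A\<close>, so distinct relations are distinct posets.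
\<close>

definition less_in :: "'a rel \<Rightarrow> 'a \<Rightarrow> 'a \<Rightarrow> bool" where
  "less_in r a b \<longleftrightarrow> (a, b) \<in> r \<and> a \<noteq> b"

definition covered_by :: "'a rel \<Rightarrow> 'a \<Rightarrow> 'a \<Rightarrow> bool" where
  "covered_by r a b \<longleftrightarrow> less_in r a b \<and> (\<nexists>c. less_in r a c \<and> less_in r c b)"

definition incomparable :: "'a rel \<Rightarrow> 'a \<Rightarrow> 'a \<Rightarrow> bool" where
  "incomparable r a b \<longleftrightarrow> (a, b) \<notin> r \<and> (b, a) \<notin> r"

text \<open>
  On \<open>A\<close>, the relation \<open>(r \<union> r\<inverse>)\<^sup>+\<close> is the equivalence relation generated by comparability;
  it is already reflexive on \<open>A\<close> because \<open>r\<close> is.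
\<close>

definition poset_components :: "'a set \<Rightarrow> 'a rel \<Rightarrow> 'a set set" where
  "poset_components A r = A // (r \<union> r\<inverse>)\<^sup>+"

definition weakly_graded :: "'a set \<Rightarrow> 'a rel \<Rightarrow> bool" where
  "weakly_graded A r \<longleftrightarrow> (\<exists>rk :: 'a \<Rightarrow> nat.
     (\<forall>a\<in>A. \<forall>b\<in>A. covered_by r a b \<longrightarrow> rk b = rk a + 1) \<and>
     (\<forall>C\<in>poset_components A r. Min (rk ` C) = 0))"

text \<open>\<open>Chains r\<close> always contains the empty chain, so the empty poset gets height 0.\<close>

definition poset_height :: "'a rel \<Rightarrow> nat" where
  "poset_height r = Max (card ` Chains r)"

definition three_plus_one_avoiding :: "'a set \<Rightarrow> 'a rel \<Rightarrow> bool" where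
  "three_plus_one_avoiding A r \<longleftrightarrow>
     \<not> (\<exists>x\<in>A. \<exists>y\<in>A. \<exists>z\<in>A. \<exists>w\<in>A. less_in r x y \<and> less_in r y z \<and>
          incomparable r w x \<and> incomparable r w y \<and> incomparable r w z)"

definition wg_posets :: "nat \<Rightarrow> nat \<Rightarrow> nat rel set" where
  "wg_posets n k = {r. partial_order_on {1..n} r \<and> weakly_graded {1..n} r \<and>
     three_plus_one_avoiding {1..n} r \<and> poset_height r = k}"

definition wg_count :: "nat \<Rightarrow> nat \<Rightarrow> nat" where
  "wg_count n k = card (wg_posets n k)"

lemma finite_wg_posets: "finite (wg_posets n k)"
proof (rule finite_subset)
  show "wg_posets n k \<subseteq> Pow ({1..n} \<times> {1..n})"
    by (auto simp: wg_posets_def partial_order_on_def preorder_on_def)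
qed simp

lemma wg_count_eq_0:
  assumes "n < k"
  shows "wg_count n k = 0"
proof -
  have "poset_height r \<le> n" if r: "partial_order_on {1..n} r" for r :: "nat rel"
  proof -
    have sub: "Chains r \<subseteq> Pow {1..n}"
      using r by (fastforce simp: Chains_def partial_order_on_def preorder_on_def)
    then have "finite (Chains r)"
      by (rule finite_subset) simp
    moreover have "{} \<in> Chains r"
      by (simp add: Chains_def)
    moreover have "card C \<le> n" if "C \<in> Chains r" for C
      using sub that card_mono[of "{1..n}" C] by auto
    ultimately show ?thesis
      unfolding poset_height_def by (subst Max_le_iff) auto
  qed
  then have "wg_posets n k = {}"
    using assms unfolding wg_posets_def by (metis (mono_tags, lifting) empty_Collect_eq leD)
  then show ?thesis
    by (simp add: wg_count_def)
qed

text \<open>By \<open>wg_count_eq_0\<close>, stopping at \<open>k = n\<close> loses no term of the sum over all \<open>k\<close>.\<close>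

definition wg_total :: "nat \<Rightarrow> nat" where
  "wg_total n = (\<Sum>k\<le>n. wg_count n k)"

text \<open>The exponent of \<open>x\<close> is \<open>N = m + n\<close>.\<close>

definition Psi :: "rat fps" where
  "Psi = Abs_fps (\<lambda>N. \<Sum>m\<le>N. 2 ^ (m * (N - m)) / (fact m * fact (N - m)))"

text \<open>
  Bivariate series are elements of \<open>\<rat>[[t]][[x]]\<close>, of type \<open>rat fps fps\<close>: the outer index is the
  exponent of \<open>x\<close>, the inner one that of \<open>t\<close>. The map \<open>in_x\<close> embeds \<open>\<rat>[[x]]\<close>.
\<close>

definition in_x :: "rat fps \<Rightarrow> rat fps fps" where
  "in_x f = Abs_fps (\<lambda>n. fps_const (fps_nth f n))"

definition t_var :: "rat fps fps" where
  "t_var = fps_const fps_X"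

definition w_gf2 :: "rat fps fps" where
  "w_gf2 = Abs_fps (\<lambda>n. Abs_fps (\<lambda>k. of_nat (wg_count n k) / fact n))"

definition w_gf :: "rat fps" where
  "w_gf = Abs_fps (\<lambda>n. of_nat (wg_total n) / fact n)"

text \<open>
  \<open>\<rat>[[t]]\<close> is not a field, but by the next two facts the library division of series is the true
  quotient whenever the denominator has constant coefficient 1 in \<open>x\<close>, and the denominator
  of the bivariate formula does.
\<close>

lemma fps_fps_divide_mult:
  fixes N D :: "rat fps fps"
  assumes "fps_nth D 0 = 1"
  shows "N / D * D = N"
proof -
  have "D * inverse D = 1"
    unfolding fps_inverse_def using assms by (intro fps_right_inverse) simp
  moreover have "N / D = N * inverse D"
    using assms by (intro fps_divide_unit) simp
  ultimately show ?thesis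
    by (simp add: mult.assoc mult.commute[of "inverse D"])
qed

lemma denominator_const_coeff:
  fixes e P t :: "rat fps fps"
  defines "e \<equiv> in_x (fps_exp 1)" and "P \<equiv> in_x Psi" and "t \<equiv> t_var"
  shows "fps_nth (e * (e + t * e + t ^ 2) +
           ((1 - 3 * e + in_x (fps_exp 2)) * t + (e - 2) * t ^ 2) * P) 0 = 1"
  by (simp add: e_def P_def t_def in_x_def t_var_def Psi_def fps_power_zeroth
      power2_eq_square algebra_simps)

end

theory Submission
  imports Defs "HOL-Library.FuncSet"
begin

text \<open>
  Posets of height at most 2 are disjoint unions of isolated points and bipartite relations. In a
  weakly graded (3+1)-avoiding poset of height \<open>h + 1 \<ge> 3\<close>, elements whose ranks differ by at least 2 are
  comparable, so the poset is determined by its rank function and by the relation \<open>C\<close> of incomparable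
  pairs in adjacent ranks. Avoidance says that no element is both a source and a target of \<open>C\<close>, and
  gradedness becomes a condition on each rank that involves only the two neighbouring pieces of
  \<open>C\<close>: at an interior rank, some element is isolated in \<open>C\<close>, or no element of the rank below is joined by \<open>C\<close>
  to all targets in this rank, or no element of the rank above is joined to all sources in it.
  Splitting off the lowest rank is then a transfer-matrix recursion with two states, and it
  translates into exponential generating functions through the product formula.
\<close>

section \<open>Exponential generating functions of set functions\<close>

text \<open>An interior rank is constrained by the piece of \<open>C\<close> below it through the
  single bit \<open>full_src\<close> and by the piece above it through the single bit
  \<open>full_tgt\<close>. Violations are counted and subtracted, so the recursion needs only the
  series of bipartite relations with prescribed bits: \<open>bip_gf\<close>, \<open>full_gf\<close>
  (for either bit, by reversing arrows) and \<open>full2_gf\<close>. The resulting 2 by 2 matrix has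
  trace \<open>rec_a\<close> and determinant \<open>- rec_b\<close>. The denominator of the theorem
  is e^(2x) (1 - rec_a t - rec_b t^2), where e^(2x) clears the negative exponentials because e^(2x)
  \<open>bip_gf\<close> = \<open>Psi\<close>. Height 3 is the threshold for two reasons: avoidance
  can only act on a chain of three elements, and such a chain makes the poset connected, so that the
  rank function starting at 0 is unique and structures correspond to posets one to one.\<close>

definition has_egf :: "('a set \<Rightarrow> rat) \<Rightarrow> rat fps \<Rightarrow> bool" where
  "has_egf f F \<longleftrightarrow> (\<forall>A. finite A \<longrightarrow> f A = fact (card A) * fps_nth F (card A))"

lemma has_egfD: "has_egf f F \<Longrightarrow> finite A \<Longrightarrow> f A = fact (card A) * fps_nth F (card A)"
  by (simp add: has_egf_def)

lemma has_egf_cong: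
  assumes "\<And>A. finite A \<Longrightarrow> f A = g A" "has_egf g G" "F = G"
  shows "has_egf f F"
  using assms by (simp add: has_egf_def)

lemma has_egf_add: "has_egf f F \<Longrightarrow> has_egf g G \<Longrightarrow> has_egf (\<lambda>A. f A + g A) (F + G)"
  by (simp add: has_egf_def algebra_simps)

lemma has_egf_diff: "has_egf f F \<Longrightarrow> has_egf g G \<Longrightarrow> has_egf (\<lambda>A. f A - g A) (F - G)"
  by (simp add: has_egf_def algebra_simps)

lemma has_egf_exp: "has_egf (\<lambda>A. c ^ card A) (fps_exp c)"
  by (simp add: has_egf_def)

lemma has_egf_1: "has_egf (\<lambda>_. 1) (fps_exp 1)"
  by (simp add: has_egf_def)

lemma has_egf_empty: "has_egf (\<lambda>A. if A = {} then 1 else 0) 1"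
  by (auto simp: has_egf_def)

lemma sum_Pow_card:
  fixes F :: "nat \<Rightarrow> rat"
  assumes "finite A"
  shows "(\<Sum>S\<in>Pow A. F (card S)) = (\<Sum>j\<le>card A. of_nat (card A choose j) * F j)"
proof -
  have "(\<Sum>S\<in>Pow A. F (card S)) = (\<Sum>j\<le>card A. \<Sum>S\<in>{S\<in>Pow A. card S = j}. F (card S))"
    using assms by (intro sum.group[symmetric]) (auto intro: card_mono)
  also have "\<dots> = (\<Sum>j\<le>card A. of_nat (card A choose j) * F j)"
    by (intro sum.cong refl) (use n_subsets[OF assms] in simp)
  finally show ?thesis .
qed

lemma has_egf_mult:
  assumes f: "has_egf f F" and g: "has_egf g G"
  shows "has_egf (\<lambda>A. \<Sum>S\<in>Pow A. f S * g (A - S)) (F * G)"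
  unfolding has_egf_def
proof (intro allI impI)
  fix A :: "'a set"
  assume A: "finite A"
  let ?n = "card A"
  have "(\<Sum>S\<in>Pow A. f S * g (A - S)) =
      (\<Sum>S\<in>Pow A. fact (card S) * fps_nth F (card S) *
         (fact (?n - card S) * fps_nth G (?n - card S)))"
    using A f g
    by (intro sum.cong refl) (auto simp: has_egf_def finite_subset card_Diff_subset)
  also have "\<dots> = (\<Sum>j\<le>?n. of_nat (?n choose j) *
      (fact j * fps_nth F j * (fact (?n - j) * fps_nth G (?n - j))))"
    by (rule sum_Pow_card[OF A])
  also have "\<dots> = (\<Sum>j\<le>?n. fact ?n * (fps_nth F j * fps_nth G (?n - j)))"
    by (intro sum.cong refl) (simp add: binomial_fact)
  also have "\<dots> = fact ?n * fps_nth (F * G) ?n"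
    by (simp add: fps_mult_nth sum_distrib_left atLeast0AtMost)
  finally show "(\<Sum>S\<in>Pow A. f S * g (A - S)) = fact ?n * fps_nth (F * G) ?n" .
qed

text \<open>Division in the algebra of set functions. In the convolution at \<open>A\<close> the
  term \<open>S = A\<close> is \<open>f A * g {}\<close> and all other terms involve
  \<open>f\<close> at proper subsets, so strong induction determines \<open>f\<close> from the
  product. A series can thus be read off from a decomposition that is easier to count together with
  an independent factor, here always \<open>c ^ card A\<close>.\<close>

lemma has_egf_cancel:
  assumes h: "has_egf (\<lambda>A. \<Sum>S\<in>Pow A. f S * g (A - S)) (F * G)"
    and g: "has_egf g G" and nz: "g {} \<noteq> 0"
  shows "has_egf f F"
  unfolding has_egf_def
proof (intro allI impI)
  define f' where "f' = (\<lambda>A :: 'a set. fact (card A) * fps_nth F (card A))"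
  have f': "has_egf f' F"
    by (simp add: f'_def has_egf_def)
  fix A :: "'a set"
  assume "finite A"
  then have "f A = f' A"
  proof (induction A rule: finite_psubset_induct)
    case (psubset A)
    have split: "(\<Sum>S\<in>Pow A. u S * g (A - S)) =
        u A * g {} + (\<Sum>S\<in>Pow A - {A}. u S * g (A - S))" for u :: "'a set \<Rightarrow> rat"
      using psubset.hyps by (subst sum.remove[of _ A]) auto
    have "(\<Sum>S\<in>Pow A. f S * g (A - S)) = (\<Sum>S\<in>Pow A. f' S * g (A - S))"
      using psubset.hyps h has_egf_mult[OF f' g] by (simp add: has_egf_def)
    moreover have "(\<Sum>S\<in>Pow A - {A}. f S * g (A - S)) = (\<Sum>S\<in>Pow A - {A}. f' S * g (A - S))"
      using psubset.IH by (intro sum.cong) auto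
    ultimately show ?case
      using nz unfolding split by simp
  qed
  then show "f A = fact (card A) * fps_nth F (card A)"
    by (simp add: f'_def)
qed

text \<open>\<open>Psi\<close> counts pairs of a subset \<open>S\<close> and an arbitrary relation
  from \<open>S\<close> to its complement, that is, bipartite graphs with a chosen
  2-colouring.\<close>

lemma has_egf_Psi: "has_egf (\<lambda>A. \<Sum>S\<in>Pow A. 2 ^ (card S * card (A - S))) Psi"
  unfolding has_egf_def
proof (intro allI impI)
  fix A :: "'a set"
  assume A: "finite A"
  let ?n = "card A"
  have "(\<Sum>S\<in>Pow A. 2 ^ (card S * card (A - S))) = (\<Sum>S\<in>Pow A. 2 ^ (card S * (?n - card S)) :: rat)"
    using A by (intro sum.cong refl) (auto simp: finite_subset card_Diff_subset)
  also have "\<dots> = (\<Sum>j\<le>?n. of_nat (?n choose j) * 2 ^ (j * (?n - j)))"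
    by (rule sum_Pow_card[OF A])
  also have "\<dots> = fact ?n * fps_nth Psi ?n"
    unfolding Psi_def by (simp add: sum_distrib_left) (intro sum.cong refl, simp add: binomial_fact)
  finally show "(\<Sum>S\<in>Pow A. 2 ^ (card S * card (A - S))) = fact ?n * fps_nth Psi ?n" .
qed

text \<open>Passing to the difference \<open>X = S - T\<close> turns nested subsets into disjoint
  pairs, the form in which products of series appear.\<close>

lemma sum_Pow_Pow:
  assumes "finite A"
  shows "(\<Sum>S\<in>Pow A. \<Sum>T\<in>Pow S. f T (S - T)) = (\<Sum>X\<in>Pow A. \<Sum>T\<in>Pow (A - X). f T X)"
proof -
  have fin: "finite S" if "S \<subseteq> A" for S
    using assms that by (rule finite_subset[rotated])
  have "(\<Sum>S\<in>Pow A. \<Sum>T\<in>Pow S. f T (S - T)) =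
      (\<Sum>(S,T)\<in>Sigma (Pow A) Pow. f T (S - T))"
    using assms fin by (subst sum.Sigma) auto
  also have "\<dots> = (\<Sum>(X,T)\<in>Sigma (Pow A) (\<lambda>X. Pow (A - X)). f T X)"
    by (rule sum.reindex_bij_witness[of _ "\<lambda>(X,T). (X \<union> T, T)" "\<lambda>(S,T). (S - T, T)"]) auto
  also have "\<dots> = (\<Sum>X\<in>Pow A. \<Sum>T\<in>Pow (A - X). f T X)"
    using assms fin by (subst sum.Sigma) auto
  finally show ?thesis .
qed

text \<open>For c = 1 or 2 each element of \<open>S\<close> picks a subset of \<open>A - S\<close>,
  with \<open>c\<close> of the subsets forbidden. Convolution with \<open>c ^ card\<close> gives the
  forbidden choices back: the binomial theorem combines 2^m - c and c into 2^m, which yields the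
  summand of \<open>Psi\<close>. The case \<open>S = A\<close> is excluded throughout; its summand
  in \<open>Psi\<close> is 1, whence the subtracted \<open>fps_exp 1\<close>.\<close>

lemma has_egf_shifted_powers:
  fixes c :: rat
  shows "has_egf (\<lambda>A :: 'a set. \<Sum>S\<in>Pow A - {A}. (2 ^ card (A - S) - c) ^ card S)
           (fps_exp (- c) * (Psi - fps_exp 1))"
proof (rule has_egf_cancel[where g = "\<lambda>A. c ^ card A" and G = "fps_exp c"])
  let ?f = "\<lambda>A S. if S = A then 0 else (2 ^ card (A - S) - c) ^ card S"
  have f: "(\<Sum>S\<in>Pow A - {A}. (2 ^ card (A - S) - c) ^ card S) = (\<Sum>S\<in>Pow A. ?f A S)"
    if "finite A" for A :: "'a set"
    using that by (intro sum.mono_neutral_cong_left) auto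
  show "has_egf (\<lambda>A :: 'a set. \<Sum>S\<in>Pow A. (\<Sum>D\<in>Pow S - {S}. (2 ^ card (S - D) - c) ^ card D) * c ^ card (A - S))
     (fps_exp (- c) * (Psi - fps_exp 1) * fps_exp c)"
  proof (rule has_egf_cong[OF _ has_egf_diff[OF has_egf_Psi has_egf_1]])
    fix A :: "'a set"
    assume A: "finite A"
    note fin = finite_subset[OF _ A]
    have "(\<Sum>S\<in>Pow A. (\<Sum>D\<in>Pow S - {S}. (2 ^ card (S - D) - c) ^ card D) * c ^ card (A - S)) =
        (\<Sum>S\<in>Pow A. (\<Sum>D\<in>Pow S. ?f S D) * c ^ card (A - S))"
      using f fin by (intro sum.cong refl) auto
    also have "\<dots> = (\<Sum>X\<in>Pow A. (\<Sum>D\<in>Pow (A - X). ?f (A - X) D * c ^ card X))"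
    proof (rule sum.reindex_bij_witness[of _ "\<lambda>X. A - X" "\<lambda>X. A - X"])
      fix S assume "S \<in> Pow A"
      then have "A - (A - S) = S" by auto
      then show "(\<Sum>D\<in>Pow (A - (A - S)). ?f (A - (A - S)) D * c ^ card (A - S)) =
          (\<Sum>D\<in>Pow S. ?f S D) * c ^ card (A - S)"
        by (simp only: sum_distrib_right)
    qed auto
    \<comment> \<open>Merging the chosen set \<open>T\<close> with the weighted set \<open>X\<close>
      into \<open>S\<close> keeps the complement \<open>A - S\<close> fixed, so for each
      \<open>S\<close> the inner sum is a binomial expansion.\<close>
    also have "\<dots> = (\<Sum>S\<in>Pow A. \<Sum>T\<in>Pow S. ?f (A - (S - T)) T * c ^ card (S - T))"
      by (rule sum_Pow_Pow[OF A, symmetric])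
    also have "\<dots> = (\<Sum>S\<in>Pow A. if S = A then 0 else 2 ^ (card S * card (A - S)))"
    proof (intro sum.cong refl)
      fix S assume "S \<in> Pow A"
      then have S: "S \<subseteq> A" "finite S" using fin by auto
      show "(\<Sum>T\<in>Pow S. ?f (A - (S - T)) T * c ^ card (S - T)) =
          (if S = A then 0 else 2 ^ (card S * card (A - S)))"
      proof (cases "S = A")
        case True
        have "A - (A - T) = T" if "T \<subseteq> A" for T using that by auto
        then show ?thesis unfolding True
          by (auto intro!: sum.neutral)
      next
        case False
        have *: "T \<noteq> A - (S - T)" "A - (S - T) - T = A - S" if "T \<subseteq> S" for T
          using that S False by auto
        have "(\<Sum>T\<in>Pow S. ?f (A - (S - T)) T * c ^ card (S - T)) =
            (\<Sum>T\<in>Pow S. (2 ^ card (A - S) - c) ^ card T * c ^ (card S - card T))"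
          using * S(2) by (intro sum.cong refl) (auto simp: card_Diff_subset finite_subset)
        also have "\<dots> = (\<Sum>j\<le>card S. of_nat (card S choose j) * ((2 ^ card (A - S) - c) ^ j * c ^ (card S - j)))"
          by (rule sum_Pow_card[OF S(2)])
        also have "\<dots> = (2 ^ card (A - S)) ^ card S"
          using binomial_ring[of "2 ^ card (A - S) - c" c "card S"] by (simp add: mult.assoc)
        finally show ?thesis using False by (simp add: power_mult[symmetric] mult.commute)
      qed
    qed
    also have "\<dots> = (\<Sum>S\<in>Pow A. 2 ^ (card S * card (A - S))) - 1"
      using A by (simp add: sum.remove[of _ A])
    finally show "(\<Sum>S\<in>Pow A. (\<Sum>D\<in>Pow S - {S}. (2 ^ card (S - D) - c) ^ card D) * c ^ card (A - S)) =
        (\<Sum>S\<in>Pow A. 2 ^ (card S * card (A - S))) - 1" .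
  next
    have "fps_exp (- c) * fps_exp c = 1"
      using fps_exp_add_mult[of "- c" c] by simp
    then show "fps_exp (- c) * (Psi - fps_exp 1) * fps_exp c = Psi - fps_exp 1"
      by (metis mult.commute mult.left_commute mult_1)
  qed
qed (auto intro: has_egf_exp)

section \<open>Bipartite relations without isolated elements\<close>

definition bip_rels :: "'a set \<Rightarrow> 'a rel set" where
  "bip_rels X = {C. Field C = X \<and> Domain C \<inter> Range C = {}}"

text \<open>The witness ranges over the whole type. If \<open>C\<close> is nonempty it lies in the
  domain. If \<open>C\<close> is empty everything is a witness, which is the value that gradedness
  needs: with no targets in the next rank, every element is vacuously joined to all of them.\<close>

definition full_src :: "'a rel \<Rightarrow> bool" where
  "full_src C \<longleftrightarrow> (\<exists>x. Range C \<subseteq> C `` {x})"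

definition full_tgt :: "'a rel \<Rightarrow> bool" where
  "full_tgt C \<longleftrightarrow> (\<exists>y. Domain C \<subseteq> C\<inverse> `` {y})"

lemma bip_subset: "C \<in> bip_rels X \<Longrightarrow> C \<subseteq> X \<times> X"
  by (auto simp: bip_rels_def Field_def)

lemma finite_bip: "finite X \<Longrightarrow> finite (bip_rels X)"
  by (rule finite_subset[of _ "Pow (X \<times> X)"]) (auto dest: bip_subset)

lemma full_src_empty [simp]: "full_src {}"
  by (simp add: full_src_def)

lemma full_tgt_empty [simp]: "full_tgt {}"
  by (simp add: full_tgt_def)

lemma bip_empty [simp]: "bip_rels {} = {{}}"
  by (auto simp: bip_rels_def Field_def)

definition bip_gf :: "rat fps" where
  "bip_gf = fps_exp (- 2) * Psi"

text \<open>A relation from \<open>S\<close> to \<open>A - S\<close> consists of a relation without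
  isolated elements on its field and a free choice of side for each remaining element. The choice of
  sides has series e^(2x), hence the factor \<open>fps_exp (- 2)\<close> in
  \<open>bip_gf\<close>.\<close>

lemma has_egf_bip: "has_egf (\<lambda>A :: 'a set. of_nat (card (bip_rels A))) bip_gf"
proof (rule has_egf_cancel[where g = "\<lambda>A. 2 ^ card A" and G = "fps_exp 2"])
  show "has_egf (\<lambda>A :: 'a set. \<Sum>S\<in>Pow A. of_nat (card (bip_rels S)) * 2 ^ card (A - S)) (bip_gf * fps_exp 2)"
  proof (rule has_egf_cong[OF _ has_egf_Psi])
    fix A :: "'a set"
    assume A: "finite A"
    note fin = finite_subset[OF _ A]
    let ?L = "SIGMA X:Pow A. bip_rels X \<times> Pow (A - X)" and ?R = "SIGMA S:Pow A. Pow (S \<times> (A - S))"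
    have "bij_betw (\<lambda>(X, C, Y). (Domain C \<union> Y, C)) ?L ?R"
      by (rule bij_betw_byWitness[where f' = "\<lambda>(S, C). (Field C, C, S - Field C)"])
        (auto simp: bip_rels_def Field_def)
    then have "card ?L = card ?R"
      by (rule bij_betw_same_card)
    moreover have "card ?L = (\<Sum>X\<in>Pow A. card (bip_rels X) * 2 ^ card (A - X))"
      using A fin by (subst card_SigmaI) (auto simp: card_Pow finite_bip card_cartesian_product intro!: sum.cong)
    moreover have "card ?R = (\<Sum>S\<in>Pow A. 2 ^ (card S * card (A - S)))"
      using A fin by (subst card_SigmaI) (auto simp: card_Pow card_cartesian_product intro!: sum.cong)
    ultimately have "(\<Sum>X\<in>Pow A. card (bip_rels X) * 2 ^ card (A - X)) =
        (\<Sum>S\<in>Pow A. 2 ^ (card S * card (A - S)))"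
      by simp
    then have "of_nat (\<Sum>X\<in>Pow A. card (bip_rels X) * 2 ^ card (A - X)) =
        (of_nat (\<Sum>S\<in>Pow A. 2 ^ (card S * card (A - S))) :: rat)"
      by (rule arg_cong)
    then show "(\<Sum>S\<in>Pow A. of_nat (card (bip_rels S)) * 2 ^ card (A - S)) =
        (\<Sum>S\<in>Pow A. 2 ^ (card S * card (A - S)) :: rat)"
      unfolding of_nat_sum of_nat_mult of_nat_power of_nat_numeral .
  next
    have "fps_exp (- 2) * fps_exp 2 = (1 :: rat fps)"
      using fps_exp_add_mult[of "- 2" "2 :: rat"] by simp
    then show "bip_gf * fps_exp 2 = Psi"
      unfolding bip_gf_def by (metis mult.commute mult.left_commute mult_1)
  qed
qed (auto intro: has_egf_exp)

section \<open>Counting relations with full sources or full targets\<close>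

lemma card_rel_images:
  assumes "finite D" "finite U" "\<And>T. T \<in> \<T> \<Longrightarrow> T \<subseteq> U"
  shows "card {C. C \<subseteq> D \<times> U \<and> (\<forall>x\<in>D. C `` {x} \<in> \<T>)} = card \<T> ^ card D"
proof -
  have bij: "bij_betw (\<lambda>C. \<lambda>x\<in>D. C `` {x}) {C. C \<subseteq> D \<times> U \<and> (\<forall>x\<in>D. C `` {x} \<in> \<T>)} (D \<rightarrow>\<^sub>E \<T>)"
  proof (rule bij_betw_byWitness[where f' = "\<lambda>f. SIGMA x:D. f x"])
    show "\<forall>f\<in>D \<rightarrow>\<^sub>E \<T>. (\<lambda>x\<in>D. (Sigma D f) `` {x}) = f"
    proof
      fix f assume "f \<in> D \<rightarrow>\<^sub>E \<T>"
      then show "(\<lambda>x\<in>D. (Sigma D f) `` {x}) = f"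
        by (intro extensionalityI[of _ D]) (auto simp: PiE_def)
    qed
    have "Sigma D f `` {x} = f x" if "x \<in> D" for f :: "'a \<Rightarrow> 'b set" and x using that by auto
    then show "(\<lambda>f. SIGMA x:D. f x) ` (D \<rightarrow>\<^sub>E \<T>) \<subseteq> {C. C \<subseteq> D \<times> U \<and> (\<forall>x\<in>D. C `` {x} \<in> \<T>)}"
      using assms(3) by (fastforce simp: PiE_iff)
  qed auto
  show ?thesis
    using assms(1) by (simp add: bij_betw_same_card[OF bij] card_PiE)
qed

text \<open>For a fixed set \<open>D\<close> of sources, \<open>C\<close> is the family of its rows.
  One full row already makes all of \<open>A - D\<close> targets, so only the rows have to be
  controlled: they must be nonempty (\<open>N\<close>), and the families in which no row is full
  (\<open>M\<close>) are removed. The empty relation on the empty set is added by hand, because the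
  sums run over proper subsets.\<close>

lemma card_bip_full_src:
  assumes A: "finite A"
  shows "of_nat (card {C \<in> bip_rels A. full_src C}) = (if A = {} then 1 else 0) +
    ((\<Sum>D\<in>Pow A - {A}. (2 ^ card (A - D) - 1) ^ card D) -
     (\<Sum>D\<in>Pow A - {A}. (2 ^ card (A - D) - 2) ^ card D) :: rat)"
proof (cases "A = {}")
  case True
  then have "{C \<in> bip_rels A. full_src C} = {{}}" by auto
  with True show ?thesis by simp
next
  case False
  note fin = finite_subset[OF _ A]
  define N where "N D = {C. C \<subseteq> D \<times> (A - D) \<and> (\<forall>x\<in>D. C `` {x} \<in> Pow (A - D) - {{}})}" for D
  define M where "M D = {C. C \<subseteq> D \<times> (A - D) \<and> (\<forall>x\<in>D. C `` {x} \<in> Pow (A - D) - {{}, A - D})}" for D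
  have "bij_betw (\<lambda>C. (Domain C, C)) {C \<in> bip_rels A. full_src C} (SIGMA D:Pow A - {A}. N D - M D)"
  proof (rule bij_betw_byWitness[where f' = snd])
    show "(\<lambda>C. (Domain C, C)) ` {C \<in> bip_rels A. full_src C} \<subseteq> (SIGMA D:Pow A - {A}. N D - M D)"
    proof clarsimp
      fix C assume C: "C \<in> bip_rels A" "full_src C"
      have R: "Range C = A - Domain C" "Domain C \<subseteq> A"
        using C(1) by (auto simp: bip_rels_def Field_def)
      obtain x where x: "Range C \<subseteq> C `` {x}" using C(2) by (auto simp: full_src_def)
      have "Range C \<noteq> {}" using R False by auto
      then have xD: "x \<in> Domain C" "Range C = C `` {x}" using x by auto
      have "C \<subseteq> Domain C \<times> (A - Domain C)" using R by auto
      then have "C \<in> N (Domain C)" unfolding N_def by auto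
      moreover have "C \<notin> M (Domain C)" using xD R by (auto simp: M_def)
      ultimately show "Domain C \<subseteq> A \<and> Domain C \<noteq> A \<and> C \<in> N (Domain C) \<and> C \<notin> M (Domain C)"
        using R \<open>Range C \<noteq> {}\<close> by auto
    qed
    have key: "D = Domain C \<and> C \<in> bip_rels A \<and> full_src C"
      if D: "D \<subseteq> A" "D \<noteq> A" and C: "C \<in> N D" "C \<notin> M D" for D C
    proof -
      from C have sub: "C \<subseteq> D \<times> (A - D)" and ne: "\<forall>x\<in>D. C `` {x} \<noteq> {}"
        unfolding N_def by auto
      from C sub obtain x where x: "x \<in> D" "C `` {x} = A - D"
        unfolding N_def M_def by auto
      have "Domain C = D" "Range C = A - D" using sub ne x by auto
      then show ?thesis using D x by (auto simp: bip_rels_def Field_def full_src_def)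
    qed
    show "\<forall>p\<in>(SIGMA D:Pow A - {A}. N D - M D). (\<lambda>C. (Domain C, C)) (snd p) = p"
    proof
      fix p assume "p \<in> (SIGMA D:Pow A - {A}. N D - M D)"
      then obtain D C where "p = (D, C)" "D \<subseteq> A" "D \<noteq> A" "C \<in> N D" "C \<notin> M D"
        by auto
      then show "(\<lambda>C. (Domain C, C)) (snd p) = p"
        using key[of D C] by simp
    qed
    show "snd ` (SIGMA D:Pow A - {A}. N D - M D) \<subseteq> {C \<in> bip_rels A. full_src C}"
    proof
      fix C assume "C \<in> snd ` (SIGMA D:Pow A - {A}. N D - M D)"
      then obtain D where "D \<subseteq> A" "D \<noteq> A" "C \<in> N D" "C \<notin> M D"
        by (elim imageE SigmaE) auto
      then show "C \<in> {C \<in> bip_rels A. full_src C}"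
        using key[of D C] by simp
    qed
  qed auto
  then have "card {C \<in> bip_rels A. full_src C} = card (SIGMA D:Pow A - {A}. N D - M D)"
    by (rule bij_betw_same_card)
  moreover have finN: "finite (N D)" if "D \<subseteq> A" for D
    using fin[OF that] A by (intro finite_subset[of "N D" "Pow (D \<times> (A - D))"]) (auto simp: N_def)
  ultimately have "card {C \<in> bip_rels A. full_src C} = (\<Sum>D\<in>Pow A - {A}. card (N D - M D))"
    using A by (subst (asm) card_SigmaI) auto
  also have "of_nat \<dots> = (\<Sum>D\<in>Pow A - {A}. (2 ^ card (A - D) - 1) ^ card D - (2 ^ card (A - D) - 2 :: rat) ^ card D)"
    unfolding of_nat_sum
  proof (intro sum.cong refl)
    fix D assume D: "D \<in> Pow A - {A}"
    then have ne: "A - D \<noteq> {}" "finite D" "finite (A - D)" using fin A by auto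
    \<comment> \<open>As \<open>A - D\<close> is nonempty, \<open>{}\<close> and
      \<open>A - D\<close> are two different forbidden rows and the truncated subtractions in
      \<open>nat\<close> are exact.\<close>
    have ge: "2 ^ card (A - D) \<ge> (2 :: nat)"
      using ne by (metis One_nat_def Suc_leI card_gt_0_iff power_increasing power_one_right one_le_numeral)
    have sub: "M D \<subseteq> N D" by (auto simp: M_def N_def)
    have cN: "card (N D) = (2 ^ card (A - D) - 1) ^ card D"
      unfolding N_def using ne by (subst card_rel_images) (auto simp: card_Pow card_Diff_subset)
    have cM: "card (M D) = (2 ^ card (A - D) - 2) ^ card D"
    proof -
      have "card (Pow (A - D) - {{}, A - D}) = 2 ^ card (A - D) - card {{}, A - D}"
        using ne by (subst card_Diff_subset) (auto simp: card_Pow)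
      also have "card {{}, A - D} = 2"
        using ne(1) by (simp add: card_insert_if)
      finally show ?thesis
        unfolding M_def using ne by (subst card_rel_images) auto
    qed
    have "card (N D - M D) = card (N D) - card (M D)" "card (M D) \<le> card (N D)"
      using sub finN[of D] D by (auto intro!: card_Diff_subset card_mono finite_subset[OF sub])
    then have "of_nat (card (N D - M D)) = (of_nat (card (N D)) - of_nat (card (M D)) :: rat)"
      by (simp add: of_nat_diff)
    then show "of_nat (card (N D - M D)) =
        (2 ^ card (A - D) - 1) ^ card D - (2 ^ card (A - D) - 2 :: rat) ^ card D"
      using ge unfolding cN cM by (simp add: of_nat_diff)
  qed
  finally show ?thesis using False by (simp add: sum_subtractf)
qed

text \<open>Simplified from 1 + (e^(-x) - e^(-2x)) (Psi - e^x). The two exponentials stem from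
  forbidding the empty row only, and from forbidding both the empty and the full row.\<close>

definition full_gf :: "rat fps" where
  "full_gf = fps_exp (- 1) + (fps_exp 1 - 1) * bip_gf"

lemma has_egf_full_src: "has_egf (\<lambda>A :: 'a set. of_nat (card {C \<in> bip_rels A. full_src C})) full_gf"
proof (rule has_egf_cong[OF card_bip_full_src])
  show "has_egf (\<lambda>A :: 'a set. (if A = {} then 1 else 0) +
    ((\<Sum>D\<in>Pow A - {A}. (2 ^ card (A - D) - 1) ^ card D) -
     (\<Sum>D\<in>Pow A - {A}. (2 ^ card (A - D) - 2) ^ card D) :: rat))
     (1 + (fps_exp (- 1) * (Psi - fps_exp 1) - fps_exp (- 2) * (Psi - fps_exp 1)))"
    by (intro has_egf_add has_egf_diff has_egf_empty has_egf_shifted_powers)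
  have e: "fps_exp (- 1) * fps_exp 1 = (1 :: rat fps)" "fps_exp 1 * fps_exp (- 2) = (fps_exp (- 1) :: rat fps)"
    by (simp_all flip: fps_exp_add_mult)
  show "full_gf = 1 + (fps_exp (- 1) * (Psi - fps_exp 1) - fps_exp (- 2) * (Psi - fps_exp 1))"
    unfolding full_gf_def bip_gf_def using e by algebra
qed

lemma card_bip_full_tgt: "card {C \<in> bip_rels A. full_tgt C} = card {C \<in> bip_rels A. full_src C}"
proof -
  have "bij_betw converse {C \<in> bip_rels A. full_tgt C} {C \<in> bip_rels A. full_src C}"
    by (rule bij_betw_byWitness[where f' = converse])
      (auto simp: bip_rels_def full_src_def full_tgt_def Field_def)
  then show ?thesis by (rule bij_betw_same_card)
qed

lemma has_egf_full_tgt: "has_egf (\<lambda>A. of_nat (card {C \<in> bip_rels A. full_tgt C})) full_gf"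
  using has_egf_full_src by (simp add: card_bip_full_tgt)

text \<open>
  Complementing a nonempty \<open>C\<close> inside \<open>Domain C \<times> Range C\<close> turns the full vertices into isolated
  ones, and what remains after their removal is an arbitrary element of \<open>bip_rels\<close>.
\<close>

lemma card_bip_full_both:
  assumes A: "finite A"
  shows "card {C \<in> bip_rels A. full_src C \<and> full_tgt C} = (if A = {} then 1 else 0) +
    (\<Sum>X\<in>Pow A. (if X = {} then 0 else 1) *
      (\<Sum>Y\<in>Pow (A - X). (if Y = {} then 0 else 1) * card (bip_rels (A - X - Y))))"
proof (cases "A = {}")
  case True
  then have "{C \<in> bip_rels A. full_src C \<and> full_tgt C} = {{}}" by auto
  with True show ?thesis by simp
next
  case False
  note fin = finite_subset[OF _ A]
  \<comment> \<open>Complement inside the rectangle of sources and targets. A source outside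
    \<open>Domain (co C)\<close> is related to every target, so \<open>dec\<close> returns the full
    sources, the full targets and the complement.\<close>
  define co where "co C = Domain C \<times> Range C - C" for C :: "'a rel"
  define dec where "dec C = (Domain C - Domain (co C), Range C - Range (co C), co C)" for C :: "'a rel"
  define enc where "enc = (\<lambda>(X, Y, C'). (X \<union> Domain C') \<times> (Y \<union> Range C') - C' :: 'a rel)"
  let ?S = "SIGMA X:Pow A - {{}}. SIGMA Y:Pow (A - X) - {{}}. bip_rels (A - X - Y)"
  have enc: "dec (enc p) = p \<and> enc p \<in> bip_rels A \<and> full_src (enc p) \<and> full_tgt (enc p)"
    if "p \<in> ?S" for p
  proof -
    from that obtain X Y C' where p: "p = (X, Y, C')" "X \<in> Pow A - {{}}"
        "Y \<in> Pow (A - X) - {{}}" "C' \<in> bip_rels (A - X - Y)"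
      by blast
    have S: "X \<noteq> {}" "Y \<noteq> {}" "X \<inter> Y = {}" "X \<union> Y \<union> Field C' = A"
        "Field C' \<inter> (X \<union> Y) = {}" "Domain C' \<inter> Range C' = {}"
      using p(2-4) by (auto simp: bip_rels_def)
    have dj: "Domain C' \<inter> X = {}" "Range C' \<inter> Y = {}" "Domain C' \<inter> Y = {}" "Range C' \<inter> X = {}"
      using S(5) by (auto simp: Field_def)
    define C where "C = (X \<union> Domain C') \<times> (Y \<union> Range C') - C'"
    \<comment> \<open>One element of \<open>X\<close> and one of \<open>Y\<close> fix the domain and
      the range of \<open>C\<close> and witness both kinds of fullness.\<close>
    obtain x y where xy: "x \<in> X" "y \<in> Y" using S(1,2) by blast
    have y: "(a, y) \<in> C" if "a \<in> X \<union> Domain C'" for a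
      using that xy dj unfolding C_def by auto
    have x: "(x, b) \<in> C" if "b \<in> Y \<union> Range C'" for b
      using that xy dj unfolding C_def by auto
    have D: "Domain C = X \<union> Domain C'"
      using y unfolding C_def by blast
    have R: "Range C = Y \<union> Range C'"
      using x unfolding C_def by blast
    have co: "co C = C'"
      unfolding co_def D R unfolding C_def by auto
    have "dec C = (X, Y, C')"
      unfolding dec_def co D R using dj by auto
    moreover have "C \<in> bip_rels A"
    proof -
      have "Field C = A"
        unfolding Field_def D R S(4)[symmetric] by blast
      moreover have "Domain C \<inter> Range C = {}"
        unfolding D R using dj S(3,6) by blast
      ultimately show ?thesis by (simp add: bip_rels_def)
    qed
    moreover have "full_src C"
      unfolding full_src_def R using x by blast
    moreover have "full_tgt C"
      unfolding full_tgt_def D using y by blast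
    moreover have "enc p = C"
      by (simp add: enc_def p C_def)
    ultimately show ?thesis by (simp add: p)
  qed
  have "bij_betw dec {C \<in> bip_rels A. full_src C \<and> full_tgt C} ?S"
  proof (rule bij_betw_byWitness[where f' = enc])
    show "\<forall>C\<in>{C \<in> bip_rels A. full_src C \<and> full_tgt C}. enc (dec C) = C"
      by (auto simp: enc_def dec_def co_def)
    show "\<forall>p\<in>?S. dec (enc p) = p"
      using enc by blast
    show "enc ` ?S \<subseteq> {C \<in> bip_rels A. full_src C \<and> full_tgt C}"
      using enc by blast
    show "dec ` {C \<in> bip_rels A. full_src C \<and> full_tgt C} \<subseteq> ?S"
    proof (intro image_subsetI, elim CollectE conjE)
      fix C assume C: "C \<in> bip_rels A" "full_src C" "full_tgt C"
      obtain x where x: "Range C \<subseteq> C `` {x}" using C(2) by (auto simp: full_src_def)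
      obtain y where y: "Domain C \<subseteq> C\<inverse> `` {y}" using C(3) by (auto simp: full_tgt_def)
      have F: "Domain C \<union> Range C = A" "Domain C \<inter> Range C = {}"
        using C(1) by (auto simp: bip_rels_def Field_def)
      then have "Domain C \<noteq> {}" "Range C \<noteq> {}" using False by auto
      then have "x \<in> Domain C - Domain (co C)" "y \<in> Range C - Range (co C)"
        using x y by (auto simp: co_def)
      moreover have co: "Domain (co C) \<subseteq> Domain C" "Range (co C) \<subseteq> Range C"
        by (auto simp: co_def)
      moreover have "co C \<in> bip_rels (A - (Domain C - Domain (co C)) - (Range C - Range (co C)))"
        using F co unfolding bip_rels_def Field_def by blast
      ultimately show "dec C \<in> ?S"
        using F unfolding dec_def by blast
    qed
  qed
  then have "card {C \<in> bip_rels A. full_src C \<and> full_tgt C} = card ?S"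
    by (rule bij_betw_same_card)
  also have "\<dots> = (\<Sum>X\<in>Pow A - {{}}. \<Sum>Y\<in>Pow (A - X) - {{}}. card (bip_rels (A - X - Y)))"
    using A by (subst card_SigmaI; (auto intro!: finite_SigmaI finite_bip sum.cong card_SigmaI))
  also have "\<dots> = (\<Sum>X\<in>Pow A. (if X = {} then 0 else 1) *
      (\<Sum>Y\<in>Pow (A - X). (if Y = {} then 0 else 1) * card (bip_rels (A - X - Y))))"
  proof -
    have *: "(\<Sum>X\<in>Pow B - {{}}. h X) = (\<Sum>X\<in>Pow B. (if X = {} then 0 else 1) * h X)"
      if "finite B" for B and h :: "'a set \<Rightarrow> nat"
      using that by (intro sum.mono_neutral_cong_left) auto
    show ?thesis using A by (simp add: *)
  qed
  finally show ?thesis using False by simp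
qed

definition full2_gf :: "rat fps" where
  "full2_gf = 1 + (fps_exp 1 - 1)\<^sup>2 * bip_gf"

lemma has_egf_full_both: "has_egf (\<lambda>A :: 'a set. of_nat (card {C \<in> bip_rels A. full_src C \<and> full_tgt C})) full2_gf"
proof (rule has_egf_cong)
  have ne: "has_egf (\<lambda>A. if A = {} then 0 else 1) (fps_exp 1 - 1)"
    by (rule has_egf_cong[OF _ has_egf_diff[OF has_egf_1 has_egf_empty]]) auto
  show "has_egf (\<lambda>A :: 'a set. (if A = {} then 1 else 0) +
    (\<Sum>X\<in>Pow A. (if X = {} then 0 else 1) *
      (\<Sum>Y\<in>Pow (A - X). (if Y = {} then 0 else 1) * of_nat (card (bip_rels (A - X - Y))))))
    (1 + (fps_exp 1 - 1) * ((fps_exp 1 - 1) * bip_gf))"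
    by (intro has_egf_add has_egf_empty has_egf_mult ne has_egf_bip)
  show "full2_gf = 1 + (fps_exp 1 - 1) * ((fps_exp 1 - 1) * bip_gf)"
    by (simp add: full2_gf_def power2_eq_square mult.assoc)
qed (simp add: card_bip_full_both of_nat_sum if_distrib[of of_nat] cong: if_cong)

section \<open>Rank functions with incomparability relations\<close>

definition level :: "('a \<Rightarrow> nat) \<Rightarrow> 'a rel \<Rightarrow> nat \<Rightarrow> 'a rel" where
  "level rk C j = {(x, y) \<in> C. rk x = j}"

text \<open>
  The condition on the rank above the piece \<open>P\<close> when it has no isolated element; \<open>h\<close> is the number of
  ranks above it. Note that \<open>full_src {}\<close> and \<open>full_tgt {}\<close> hold.
\<close>

definition rank_above_ok :: "nat \<Rightarrow> 'a rel \<Rightarrow> 'a rel \<Rightarrow> bool" where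
  "rank_above_ok h P C \<longleftrightarrow> (if h = 0 then P \<noteq> {} else \<not> full_src P \<or> \<not> full_tgt C)"

text \<open>\<open>b j\<close> stands for an element of rank \<open>j\<close> isolated in
  \<open>C\<close>, and \<open>L j\<close> for the piece of \<open>C\<close> from rank
  \<open>j\<close> to rank \<open>j + 1\<close>. Rank 0 is governed by \<open>\<gamma>\<close>.
  Since \<open>h - j\<close> is the number of ranks above \<open>j\<close>, a top rank other than
  rank 0 only has to be nonempty.\<close>

definition levels_ok :: "nat \<Rightarrow> ('a rel \<Rightarrow> bool) \<Rightarrow> (nat \<Rightarrow> bool) \<Rightarrow> (nat \<Rightarrow> 'a rel) \<Rightarrow> bool" where
  "levels_ok h \<gamma> b L \<longleftrightarrow> (\<forall>j\<le>h. b j \<or> (case j of 0 \<Rightarrow> \<gamma> (L 0) | Suc i \<Rightarrow> rank_above_ok (h - j) (L i) (L j)))"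

text \<open>
  The predicate \<open>\<gamma>\<close> is a parameter because it records, in the recursion, the piece of \<open>C\<close> between the
  lowest rank and the rank that was split off before.
\<close>

definition rank_structs :: "nat \<Rightarrow> ('a rel \<Rightarrow> bool) \<Rightarrow> 'a set \<Rightarrow> (('a \<Rightarrow> nat) \<times> 'a rel) set" where
  "rank_structs h \<gamma> A = {(rk, C). rk \<in> A \<rightarrow>\<^sub>E {..h} \<and> C \<subseteq> A \<times> A \<and> Domain C \<inter> Range C = {} \<and>
     (\<forall>(x, y)\<in>C. rk y = Suc (rk x)) \<and>
     levels_ok h \<gamma> (\<lambda>j. \<exists>v\<in>A - Field C. rk v = j) (level rk C)}"

lemma finite_rank_structs: "finite A \<Longrightarrow> finite (rank_structs h \<gamma> A)"
  by (rule finite_subset[of _ "(A \<rightarrow>\<^sub>E {..h}) \<times> Pow (A \<times> A)"])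
    (auto simp: rank_structs_def intro: finite_PiE)

section \<open>Splitting off the lowest rank\<close>

lemma all_le_Suc_iff: "(\<forall>j\<le>Suc h. P j) \<longleftrightarrow> P 0 \<and> (\<forall>j\<le>h. P (Suc j))"
  by (metis Suc_le_mono le0 not0_implies_Suc)

lemma levels_ok_0: "levels_ok 0 \<gamma> b L \<longleftrightarrow> b 0 \<or> \<gamma> (L 0)"
  by (simp add: levels_ok_def)

text \<open>Deleting rank 0 shifts all indices by one but keeps the number of ranks above. The piece
  \<open>L 0\<close> survives only inside the predicate \<open>rank_above_ok h (L 0)\<close>, which
  takes the place of \<open>\<gamma>\<close>.\<close>

lemma levels_ok_Suc: "levels_ok (Suc h) \<gamma> b L \<longleftrightarrow>
    (b 0 \<or> \<gamma> (L 0)) \<and> levels_ok h (rank_above_ok h (L 0)) (\<lambda>j. b (Suc j)) (\<lambda>j. L (Suc j))"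
proof -
  have "(case Suc j of 0 \<Rightarrow> \<gamma> (L 0) | Suc i \<Rightarrow> rank_above_ok (Suc h - Suc j) (L i) (L (Suc j))) \<longleftrightarrow>
      (case j of 0 \<Rightarrow> rank_above_ok h (L 0) (L (Suc 0)) | Suc i \<Rightarrow> rank_above_ok (h - j) (L (Suc i)) (L (Suc j)))" for j
    by (cases j) auto
  then show ?thesis
    unfolding levels_ok_def all_le_Suc_iff by simp
qed

lemma levels_ok_cong: "(\<And>j. b j \<longleftrightarrow> b' j) \<Longrightarrow> (\<And>j. L j = L' j) \<Longrightarrow> levels_ok h \<gamma> b L \<longleftrightarrow> levels_ok h \<gamma> b' L'"
proof -
  assume "\<And>j. b j \<longleftrightarrow> b' j" "\<And>j. L j = L' j"
  then have "b = b'" "L = L'" by auto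
  then show ?thesis by simp
qed

lemma rank_structs_0: "rank_structs 0 \<gamma> A = (if A \<noteq> {} \<or> \<gamma> {} then {(\<lambda>v\<in>A. 0, {})} else {})"
proof -
  have "(rk, C) \<in> rank_structs 0 \<gamma> A \<longleftrightarrow> (A \<noteq> {} \<or> \<gamma> {}) \<and> rk = (\<lambda>v\<in>A. 0) \<and> C = {}" for rk C
  proof
    assume a: "(rk, C) \<in> rank_structs 0 \<gamma> A"
    then have rk: "rk \<in> A \<rightarrow>\<^sub>E {..0}" and C: "C \<subseteq> A \<times> A" "\<forall>(x, y)\<in>C. rk y = Suc (rk x)"
      and ok: "levels_ok 0 \<gamma> (\<lambda>j. \<exists>v\<in>A - Field C. rk v = j) (level rk C)"
      by (auto simp: rank_structs_def)
    from rk have 1: "rk = (\<lambda>v\<in>A. 0)"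
      by (intro extensionalityI[of _ A]) (auto simp: PiE_iff)
    have 2: "C = {}"
      using C rk by (fastforce simp: PiE_iff)
    show "(A \<noteq> {} \<or> \<gamma> {}) \<and> rk = (\<lambda>v\<in>A. 0) \<and> C = {}"
      using ok 1 2 by (auto simp: levels_ok_0 level_def)
  qed (auto simp: rank_structs_def levels_ok_0 level_def)
  then show ?thesis by auto
qed

text \<open>\<open>B\<close> collects the isolated elements of rank 0, \<open>C\<close> is the
  lowest piece and \<open>X\<close> its field. Removing \<open>X\<close> takes the targets of that
  piece out of rank 1 as well; this is consistent because no other pair involves them. What remains
  is a structure with all ranks lowered by one.\<close>

lemma card_rank_structs_Suc:
  assumes A: "finite A"
  shows "card (rank_structs (Suc h) \<gamma> A) = (\<Sum>B\<in>Pow A. \<Sum>X\<in>Pow (A - B). \<Sum>C\<in>bip_rels X.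
    if B \<noteq> {} \<or> \<gamma> C then card (rank_structs h (rank_above_ok h C) (A - B - X)) else 0)"
proof -
  let ?S = "SIGMA B:Pow A. SIGMA X:Pow (A - B). SIGMA C:bip_rels X.
     if B \<noteq> {} \<or> \<gamma> C then rank_structs h (rank_above_ok h C) (A - B - X) else {}"
  define dec where "dec = (\<lambda>(rk :: 'a \<Rightarrow> nat, C :: 'a rel). let B = {v \<in> A - Field C. rk v = 0};
      X = Field (level rk C 0) in (B, X, level rk C 0, \<lambda>v\<in>A - B - X. rk v - 1, C - level rk C 0))"
  define enc where "enc = (\<lambda>(B :: 'a set, X :: 'a set, C0 :: 'a rel, rk :: 'a \<Rightarrow> nat, C' :: 'a rel).
      (\<lambda>v\<in>A. if v \<in> B \<union> Domain C0 then 0 else if v \<in> Range C0 then 1 else Suc (rk v), C0 \<union> C'))"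
  have dec: "dec p \<in> ?S \<and> enc (dec p) = p" if "p \<in> rank_structs (Suc h) \<gamma> A" for p
  proof -
    obtain rk C where p: "p = (rk, C)" by (cases p)
    from that have rk: "rk \<in> A \<rightarrow>\<^sub>E {..Suc h}" and C: "C \<subseteq> A \<times> A" "Domain C \<inter> Range C = {}"
      and C_rk: "\<And>x y. (x, y) \<in> C \<Longrightarrow> rk y = Suc (rk x)"
      and ok: "levels_ok (Suc h) \<gamma> (\<lambda>j. \<exists>v\<in>A - Field C. rk v = j) (level rk C)"
      by (auto simp: rank_structs_def p)
    define B where "B = {v \<in> A - Field C. rk v = 0}"
    define C0 where "C0 = level rk C 0"
    define X where "X = Field C0"
    define rk' where "rk' = (\<lambda>v\<in>A - B - X. rk v - 1)"
    define C' where "C' = C - C0"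
    have dec: "dec p = (B, X, C0, rk', C')"
      by (simp add: dec_def p B_def C0_def X_def rk'_def C'_def Let_def)
    have C0: "C0 \<subseteq> C" "Domain C0 \<inter> Range C0 = {}"
      using C by (auto simp: C0_def level_def)
    have X: "X \<subseteq> A - B"
    proof -
      have "Field C0 \<subseteq> Field C" "Field C \<subseteq> A"
        using C C0 by (auto simp: Field_def)
      then show ?thesis by (auto simp: X_def B_def)
    qed
    \<comment> \<open>This rests on \<open>C\<close> having no paths: a source of the lowest piece
      has rank 0, so all its pairs lie in \<open>C0\<close>; a target starts no pair, and every pair
      ending in it starts in rank 0.\<close>
    have disj: "Field C' \<inter> X = {}"
    proof -
      have "v \<notin> Field C'" if v: "v \<in> X" for v
      proof
        assume "v \<in> Field C'"
        then consider y where "(v, y) \<in> C" "rk v \<noteq> 0" | x where "(x, v) \<in> C" "rk x \<noteq> 0"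
          by (auto simp: Field_def C'_def C0_def level_def)
        then show False
        proof cases
          case 1
          then have "v \<notin> Range C" using C(2) by blast
          with 1 v show False by (auto simp: X_def C0_def level_def Field_def)
        next
          case 2
          then have "v \<notin> Domain C" using C(2) by blast
          with v obtain y where "(y, v) \<in> C" "rk y = 0"
            by (auto simp: X_def C0_def level_def Field_def)
          with 2 C_rk[of x v] C_rk[of y v] show False by simp
        qed
      qed
      then show ?thesis by blast
    qed
    have FC: "Field C = X \<union> Field C'"
      using C0 unfolding X_def C'_def Field_def by auto
    have C'sub: "C' \<subseteq> (A - B - X) \<times> (A - B - X)"
    proof
      fix z assume z: "z \<in> C'"
      then have "fst z \<in> Field C'" "snd z \<in> Field C'"
        by (auto simp: Field_def Domain_iff Range_iff) (metis prod.collapse)+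
      moreover have "z \<in> A \<times> A" "z \<in> C" using z C by (auto simp: C'_def)
      moreover have "Field C' \<inter> B = {}" unfolding B_def FC by auto
      ultimately show "z \<in> (A - B - X) \<times> (A - B - X)"
        using disj by (cases z) auto
    qed
    \<comment> \<open>Ranks outside \<open>B\<close> and \<open>X\<close> are positive, so the
      truncated \<open>rk v - 1\<close> loses nothing and \<open>enc\<close> can restore
      \<open>rk\<close>.\<close>
    have pos: "rk v > 0" if v: "v \<in> A - B - X" for v
    proof (rule ccontr)
      assume "\<not> rk v > 0"
      then have 0: "rk v = 0" by simp
      then have "v \<in> Field C" using v by (auto simp: B_def)
      moreover have "v \<notin> Range C" using C_rk 0 by fastforce
      ultimately obtain y where "(v, y) \<in> C" by (auto simp: Field_def)
      then have "(v, y) \<in> C0" using 0 by (simp add: C0_def level_def)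
      then show False using v by (auto simp: X_def Field_def)
    qed
    have ok': "B \<noteq> {} \<or> \<gamma> C0" "levels_ok h (rank_above_ok h C0) (\<lambda>j. \<exists>v\<in>A - Field C. rk v = Suc j) (\<lambda>j. level rk C (Suc j))"
      using ok unfolding levels_ok_Suc by (auto simp: B_def C0_def)
    have "levels_ok h (rank_above_ok h C0) (\<lambda>j. \<exists>v\<in>(A - B - X) - Field C'. rk' v = j) (level rk' C')"
    proof (rule levels_ok_cong[THEN iffD1, OF _ _ ok'(2)])
      fix j
      show "(\<exists>v\<in>A - Field C. rk v = Suc j) \<longleftrightarrow> (\<exists>v\<in>(A - B - X) - Field C'. rk' v = j)"
      proof
        assume "\<exists>v\<in>A - Field C. rk v = Suc j"
        then obtain v where "v \<in> A - Field C" "rk v = Suc j" by blast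
        then show "\<exists>v\<in>(A - B - X) - Field C'. rk' v = j"
          by (intro bexI[of _ v]) (auto simp: FC rk'_def B_def)
      next
        assume "\<exists>v\<in>(A - B - X) - Field C'. rk' v = j"
        then obtain v where v: "v \<in> A - B - X" "v \<notin> Field C'" "rk' v = j" by blast
        then show "\<exists>v\<in>A - Field C. rk v = Suc j"
          using pos[of v] by (intro bexI[of _ v]) (auto simp: FC rk'_def)
      qed
      show "level rk C (Suc j) = level rk' C' j"
      proof -
        have "(x, y) \<in> level rk C (Suc j) \<longleftrightarrow> (x, y) \<in> level rk' C' j" for x y
        proof -
          have "rk' x = rk x - 1" "rk x > 0" if "(x, y) \<in> C'"
            using that C'sub pos[of x] by (auto simp: rk'_def)
          then show ?thesis by (auto simp: level_def C'_def C0_def)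
        qed
        then show ?thesis by auto
      qed
    qed
    moreover have "rk' \<in> (A - B - X) \<rightarrow>\<^sub>E {..h}"
      using rk by (fastforce simp: rk'_def PiE_iff)
    moreover have "\<forall>(x, y)\<in>C'. rk' y = Suc (rk' x)"
    proof clarify
      fix x y assume xy: "(x, y) \<in> C'"
      then have "x \<in> A - B - X" "y \<in> A - B - X" "(x, y) \<in> C"
        using C'sub by (auto simp: C'_def)
      then show "rk' y = Suc (rk' x)"
        using C_rk pos[of x] by (simp add: rk'_def)
    qed
    moreover have "Domain C' \<inter> Range C' = {}"
      using C by (auto simp: C'_def)
    ultimately have "(rk', C') \<in> rank_structs h (rank_above_ok h C0) (A - B - X)"
      using C'sub by (simp add: rank_structs_def)
    moreover have "C0 \<in> bip_rels X" using C0 by (simp add: bip_rels_def X_def)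
    ultimately have S: "dec p \<in> ?S"
      unfolding dec using X ok'(1) by (auto simp: B_def)
    have "rk = (\<lambda>v\<in>A. if v \<in> B \<union> Domain C0 then 0 else if v \<in> Range C0 then 1 else Suc (rk' v))"
    proof (rule extensionalityI[of _ A])
      fix v assume v: "v \<in> A"
      have "rk v = 0" if "v \<in> B \<union> Domain C0"
        using that by (auto simp: B_def C0_def level_def)
      moreover have "rk v = 1" if "v \<in> Range C0"
        using that C_rk by (auto simp: C0_def level_def)
      moreover have "rk v = Suc (rk' v)" if "v \<notin> B \<union> Domain C0" "v \<notin> Range C0"
      proof -
        have "v \<in> A - B - X" using that v by (auto simp: X_def Field_def)
        then show ?thesis using pos[of v] by (simp add: rk'_def)
      qed
      ultimately show "rk v = (\<lambda>v\<in>A. if v \<in> B \<union> Domain C0 then 0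
          else if v \<in> Range C0 then 1 else Suc (rk' v)) v"
        using v by auto
    qed (use rk in \<open>auto simp: PiE_iff\<close>)
    moreover have "C = C0 \<union> C'" using C0 by (auto simp: C'_def)
    ultimately have "enc (dec p) = p"
      unfolding dec unfolding p by (simp add: enc_def)
    with S show ?thesis by blast
  qed
  have enc: "enc q \<in> rank_structs (Suc h) \<gamma> A \<and> dec (enc q) = q" if "q \<in> ?S" for q
  proof -
    obtain B X C0 rk' C' where q: "q = (B, X, C0, rk', C')"
      by (cases q)
    with that have B: "B \<subseteq> A" and X: "X \<subseteq> A - B" and C0: "C0 \<in> bip_rels X"
      and "(rk', C') \<in> (if B \<noteq> {} \<or> \<gamma> C0 then rank_structs h (rank_above_ok h C0) (A - B - X) else {})"
      by simp_all
    then have ok0: "B \<noteq> {} \<or> \<gamma> C0" and rs: "(rk', C') \<in> rank_structs h (rank_above_ok h C0) (A - B - X)"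
      by (auto split: if_splits)
    from rs have rk': "rk' \<in> (A - B - X) \<rightarrow>\<^sub>E {..h}" and C': "C' \<subseteq> (A - B - X) \<times> (A - B - X)"
      "Domain C' \<inter> Range C' = {}" and C'_rk: "\<And>x y. (x, y) \<in> C' \<Longrightarrow> rk' y = Suc (rk' x)"
      and ok': "levels_ok h (rank_above_ok h C0) (\<lambda>j. \<exists>v\<in>(A - B - X) - Field C'. rk' v = j) (level rk' C')"
      by (auto simp: rank_structs_def)
    define rk where "rk = (\<lambda>v\<in>A. if v \<in> B \<union> Domain C0 then 0 else if v \<in> Range C0 then 1 else Suc (rk' v))"
    define C where "C = C0 \<union> C'"
    have FX: "Field C0 = X" "Domain C0 \<inter> Range C0 = {}" "Domain C0 \<subseteq> X" "Range C0 \<subseteq> X"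
      using C0 by (auto simp: bip_rels_def Field_def)
    have FC': "Field C' \<subseteq> A - B - X" "Domain C' \<subseteq> A - B - X" "Range C' \<subseteq> A - B - X"
      using C' by (auto simp: Field_def)
    have FC: "Field C = X \<union> Field C'"
      by (simp add: C_def Field_Un FX)
    have XA: "X \<subseteq> A" using X by auto
    have rk0: "rk v = 0" if "v \<in> B \<union> Domain C0" for v
      using that B FX(3) XA by (auto simp: rk_def)
    have rk1: "rk v = 1" if "v \<in> Range C0" for v
      using that B X FX by (auto simp: rk_def)
    have rkS: "rk v = Suc (rk' v)" if "v \<in> A - B - X" for v
      using that FX by (auto simp: rk_def)
    have L0: "level rk C 0 = C0"
    proof -
      have "(x, y) \<in> level rk C 0 \<longleftrightarrow> (x, y) \<in> C0" for x y
      proof -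
        have "rk x = 0" if "(x, y) \<in> C0" using that rk0[of x] by blast
        moreover have "rk x = Suc (rk' x)" if "(x, y) \<in> C'" using that rkS[of x] FC' by blast
        ultimately show ?thesis by (auto simp: level_def C_def)
      qed
      then show ?thesis by auto
    qed
    have LS: "level rk C (Suc j) = level rk' C' j" for j
    proof -
      have "(x, y) \<in> level rk C (Suc j) \<longleftrightarrow> (x, y) \<in> level rk' C' j" for x y
      proof -
        have "rk x = 0" if "(x, y) \<in> C0" using that rk0[of x] by blast
        moreover have "rk x = Suc (rk' x)" if "(x, y) \<in> C'" using that rkS[of x] FC' by blast
        ultimately show ?thesis by (auto simp: level_def C_def)
      qed
      then show ?thesis by auto
    qed
    have B': "{v \<in> A - Field C. rk v = 0} = B"
    proof -
      have "v \<in> A - Field C \<and> rk v = 0 \<longleftrightarrow> v \<in> B" for v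
      proof (cases "v \<in> B")
        case True
        then show ?thesis using rk0[of v] FC' B X unfolding FC by blast
      next
        case False
        then show ?thesis using rkS[of v] unfolding FC by auto
      qed
      then show ?thesis by auto
    qed
    have b: "(\<exists>v\<in>A - Field C. rk v = Suc j) \<longleftrightarrow> (\<exists>v\<in>(A - B - X) - Field C'. rk' v = j)" for j
    proof
      assume "\<exists>v\<in>A - Field C. rk v = Suc j"
      then obtain v where v: "v \<in> A - Field C" "rk v = Suc j" by blast
      then have "v \<notin> B" using rk0[of v] by auto
      then show "\<exists>v\<in>(A - B - X) - Field C'. rk' v = j"
        using v rkS[of v] unfolding FC by (intro bexI[of _ v]) auto
    next
      assume "\<exists>v\<in>(A - B - X) - Field C'. rk' v = j"
      then obtain v where v: "v \<in> (A - B - X) - Field C'" "rk' v = j" by blast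
      then show "\<exists>v\<in>A - Field C. rk v = Suc j"
        using rkS[of v] unfolding FC by (intro bexI[of _ v]) auto
    qed
    have enc: "enc q = (rk, C)" by (simp add: enc_def q rk_def C_def)
    have "rk \<in> A \<rightarrow>\<^sub>E {..Suc h}"
      unfolding rk_def using rk' FX by (auto simp: PiE_iff Field_def)
    moreover have "C \<subseteq> A \<times> A"
      using C' bip_subset[OF C0] XA unfolding C_def by blast
    moreover have "Domain C \<inter> Range C = {}"
      using FX FC' C'(2) unfolding C_def by blast
    moreover have "\<forall>(x, y)\<in>C. rk y = Suc (rk x)"
    proof clarify
      fix x y assume "(x, y) \<in> C"
      then consider "(x, y) \<in> C0" | "(x, y) \<in> C'" by (auto simp: C_def)
      then show "rk y = Suc (rk x)"
      proof cases
        case 1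
        then have "x \<in> B \<union> Domain C0" "y \<in> Range C0" by auto
        then show ?thesis using rk0[of x] rk1[of y] by simp
      next
        case 2
        then have "x \<in> A - B - X" "y \<in> A - B - X" using C' by auto
        then show ?thesis using 2 rkS[of x] rkS[of y] C'_rk[of x y] by simp
      qed
    qed
    moreover have "levels_ok (Suc h) \<gamma> (\<lambda>j. \<exists>v\<in>A - Field C. rk v = j) (level rk C)"
      unfolding levels_ok_Suc L0 LS b using ok0 ok' B' by auto
    ultimately have S: "enc q \<in> rank_structs (Suc h) \<gamma> A"
      unfolding enc by (simp add: rank_structs_def)
    have "(\<lambda>v\<in>A - B - X. rk v - 1) = rk'"
      by (rule extensionalityI[of _ "A - B - X"]) (use rk' rkS in \<open>auto simp: PiE_iff\<close>)
    moreover have "C - C0 = C'"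
    proof -
      have "C' \<inter> C0 = {}" using C'(1) bip_subset[OF C0] by blast
      then show ?thesis unfolding C_def by blast
    qed
    ultimately have "dec (enc q) = q"
      unfolding enc dec_def prod.case L0 B' FX Let_def unfolding q by simp
    with S show ?thesis by blast
  qed
  have "bij_betw dec (rank_structs (Suc h) \<gamma> A) ?S"
    by (rule bij_betw_byWitness[where f' = enc]) (use enc dec in blast)+
  then have "card (rank_structs (Suc h) \<gamma> A) = card ?S"
    by (rule bij_betw_same_card)
  also have "\<dots> = (\<Sum>B\<in>Pow A. \<Sum>X\<in>Pow (A - B). \<Sum>C\<in>bip_rels X.
    if B \<noteq> {} \<or> \<gamma> C then card (rank_structs h (rank_above_ok h C) (A - B - X)) else 0)"
  proof -
    have fin: "finite (bip_rels X)" "finite (A - B - X)" if "X \<subseteq> A - B" for X B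
      using that A by (auto intro!: finite_bip intro: finite_subset)
    have fi: "finite (if P then rank_structs h (rank_above_ok h C) (A - B - X) else {})" for P C B X
      using A by (auto intro: finite_rank_structs)
    let ?R = "\<lambda>B X. SIGMA C:bip_rels X. if B \<noteq> {} \<or> \<gamma> C then rank_structs h (rank_above_ok h C) (A - B - X) else {}"
    have 1: "finite (?R B X)" if "X \<subseteq> A - B" for X B
      using fin[OF that] fi by (intro finite_SigmaI)
    have 2: "card (?R B X) = (\<Sum>C\<in>bip_rels X.
        if B \<noteq> {} \<or> \<gamma> C then card (rank_structs h (rank_above_ok h C) (A - B - X)) else 0)"
      if "X \<subseteq> A - B" for X B
      using fin(1)[OF that] fi by (subst card_SigmaI) (auto intro!: sum.cong)
    have "card (SIGMA X:Pow (A - B). ?R B X) = (\<Sum>X\<in>Pow (A - B). card (?R B X))" for B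
      by (intro card_SigmaI ballI 1) (use A in auto)
    moreover have "finite (SIGMA X:Pow (A - B). ?R B X)" for B
      by (intro finite_SigmaI 1) (use A in auto)
    ultimately have "card ?S = (\<Sum>B\<in>Pow A. \<Sum>X\<in>Pow (A - B). card (?R B X))"
      using A by (subst card_SigmaI) auto
    also have "\<dots> = (\<Sum>B\<in>Pow A. \<Sum>X\<in>Pow (A - B). \<Sum>C\<in>bip_rels X.
        if B \<noteq> {} \<or> \<gamma> C then card (rank_structs h (rank_above_ok h C) (A - B - X)) else 0)"
      using 2 by (intro sum.cong refl) auto
    finally show ?thesis .
  qed
  finally show ?thesis .
qed

text \<open>A lowest piece satisfying \<open>\<delta>\<close> together with a structure of ranks 0
  to \<open>h\<close> on the remaining elements; isolated elements of the lowest rank are supplied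
  separately. The two states of the recursion are \<open>\<delta>\<close> constantly true and
  \<open>\<delta> = full_tgt\<close>. Values are rational because violations get subtracted.\<close>

definition tail_sum :: "('a rel \<Rightarrow> bool) \<Rightarrow> nat \<Rightarrow> 'a set \<Rightarrow> rat" where
  "tail_sum \<delta> h A = (\<Sum>X\<in>Pow A. \<Sum>C\<in>bip_rels X.
     if \<delta> C then of_nat (card (rank_structs h (rank_above_ok h C) (A - X))) else 0)"

lemma sum_bip_indicator:
  "finite X \<Longrightarrow> (\<Sum>C\<in>bip_rels X. if \<delta> C then c else 0 :: rat) = of_nat (card {C \<in> bip_rels X. \<delta> C}) * c"
  using finite_bip[of X] by (simp add: sum.If_cases Int_def)

text \<open>The condition \<open>\<gamma>\<close> binds only when \<open>B\<close> is empty: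
  everything is counted, and the configurations with \<open>B = {}\<close> that violate
  \<open>\<gamma>\<close> are subtracted. The factor 1 exhibits the first sum as a product with
  e^x.\<close>

lemma rank_structs_Suc_tail_sum:
  assumes A: "finite A"
  shows "of_nat (card (rank_structs (Suc h) \<gamma> A)) =
    (\<Sum>B\<in>Pow A. 1 * tail_sum (\<lambda>_. True) h (A - B)) - tail_sum (\<lambda>C. \<not> \<gamma> C) h A"
proof -
  have "tail_sum \<gamma> h A + tail_sum (\<lambda>C. \<not> \<gamma> C) h A = tail_sum (\<lambda>_. True) h A"
    unfolding tail_sum_def sum.distrib[symmetric] by (intro sum.cong refl) auto
  then have \<gamma>: "tail_sum \<gamma> h A = tail_sum (\<lambda>_. True) h A - tail_sum (\<lambda>C. \<not> \<gamma> C) h A"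
    by simp
  have "of_nat (card (rank_structs (Suc h) \<gamma> A)) =
      (\<Sum>B\<in>Pow A. tail_sum (\<lambda>C. B \<noteq> {} \<or> \<gamma> C) h (A - B))"
    unfolding card_rank_structs_Suc[OF A] tail_sum_def of_nat_sum
    by (intro sum.cong refl) auto
  also have "\<dots> = tail_sum \<gamma> h A + (\<Sum>B\<in>Pow A - {{}}. tail_sum (\<lambda>C. B \<noteq> {} \<or> \<gamma> C) h (A - B))"
    using A by (subst sum.remove[of _ "{}"]) auto
  also have "(\<Sum>B\<in>Pow A - {{}}. tail_sum (\<lambda>C. B \<noteq> {} \<or> \<gamma> C) h (A - B)) =
      (\<Sum>B\<in>Pow A - {{}}. tail_sum (\<lambda>_. True) h (A - B))"
    by (intro sum.cong refl) auto
  also have "tail_sum \<gamma> h A + \<dots> =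
      (\<Sum>B\<in>Pow A. tail_sum (\<lambda>_. True) h (A - B)) - tail_sum (\<lambda>C. \<not> \<gamma> C) h A"
    unfolding \<gamma> using A by (simp add: sum.remove[of "Pow A" "{}"])
  finally show ?thesis by simp
qed

text \<open>With ranks above, \<open>rank_above_ok\<close> fails exactly if \<open>P\<close> has a
  full source and the next piece a full target. So \<open>P\<close> influences the count through one
  bit, which closes the recursion on two states.\<close>

lemma rank_structs_rank_above_tail_sum:
  assumes A: "finite A"
  shows "of_nat (card (rank_structs (Suc h) (rank_above_ok (Suc h) P) A)) =
    (\<Sum>B\<in>Pow A. 1 * tail_sum (\<lambda>_. True) h (A - B)) -
      (if full_src P then tail_sum full_tgt h A else 0)"
  unfolding rank_structs_Suc_tail_sum[OF A] by (simp add: rank_above_ok_def tail_sum_def)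

lemma tail_sum_Suc:
  assumes A: "finite A"
  shows "tail_sum \<delta> (Suc h) A =
    (\<Sum>X\<in>Pow A. of_nat (card {C \<in> bip_rels X. \<delta> C}) * (\<Sum>B\<in>Pow (A - X). 1 * tail_sum (\<lambda>_. True) h (A - X - B))) -
    (\<Sum>X\<in>Pow A. of_nat (card {C \<in> bip_rels X. \<delta> C \<and> full_src C}) * tail_sum full_tgt h (A - X))"
  unfolding tail_sum_def[of \<delta>] sum_subtractf[symmetric]
proof (intro sum.cong refl)
  fix X assume "X \<in> Pow A"
  then have X: "finite X" and AX: "finite (A - X)" using A by (auto intro: finite_subset)
  let ?c = "\<Sum>B\<in>Pow (A - X). 1 * tail_sum (\<lambda>_. True) h (A - X - B)" and ?t = "tail_sum full_tgt h (A - X)"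
  have "(\<Sum>C\<in>bip_rels X. if \<delta> C then of_nat (card (rank_structs (Suc h) (rank_above_ok (Suc h) C) (A - X))) else 0) =
      (\<Sum>C\<in>bip_rels X. (if \<delta> C then ?c else 0) - (if \<delta> C \<and> full_src C then ?t else 0))"
    unfolding rank_structs_rank_above_tail_sum[OF AX] by (intro sum.cong refl) auto
  also have "\<dots> = of_nat (card {C \<in> bip_rels X. \<delta> C}) * ?c - of_nat (card {C \<in> bip_rels X. \<delta> C \<and> full_src C}) * ?t"
    unfolding sum_subtractf using sum_bip_indicator[OF X] by simp
  finally show "(\<Sum>C\<in>bip_rels X. if \<delta> C then of_nat (card (rank_structs (Suc h) (rank_above_ok (Suc h) C) (A - X))) else 0) =
      of_nat (card {C \<in> bip_rels X. \<delta> C}) * ?c - of_nat (card {C \<in> bip_rels X. \<delta> C \<and> full_src C}) * ?t" .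
qed

text \<open>Above the last piece sits a single rank, whose structure is unique and exists unless the
  leftover and the piece are both empty, that is, unless \<open>A\<close> is empty. The assumption
  on \<open>\<delta>\<close> makes the correction exact in that case.\<close>

lemma tail_sum_0:
  assumes A: "finite A" and \<delta>: "\<delta> {}"
  shows "tail_sum \<delta> 0 A = (\<Sum>X\<in>Pow A. of_nat (card {C \<in> bip_rels X. \<delta> C}) * 1) - (if A = {} then 1 else 0)"
proof -
  \<comment> \<open>The correction may be put into every summand: where it is nonzero
    \<open>A\<close> is empty, and then there is exactly one summand.\<close>
  have "tail_sum \<delta> 0 A = (\<Sum>X\<in>Pow A. \<Sum>C\<in>bip_rels X. (if \<delta> C then 1 else 0) -
      (if A = {} then 1 else 0))"
    unfolding tail_sum_def
  proof (intro sum.cong refl)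
    fix X C assume "X \<in> Pow A" and C: "C \<in> bip_rels X"
    then have X: "X \<subseteq> A" by simp
    have *: "A - X \<noteq> {} \<or> C \<noteq> {} \<longleftrightarrow> A \<noteq> {}"
    proof (cases "A = {}")
      case True
      then show ?thesis using X C by simp
    next
      case False
      then show ?thesis using X C by (auto simp: bip_rels_def)
    qed
    show "(if \<delta> C then of_nat (card (rank_structs 0 (rank_above_ok 0 C) (A - X))) else 0) =
        (if \<delta> C then 1 else 0) - (if A = {} then 1 else (0 :: rat))"
      using X C \<delta> * unfolding rank_structs_0 rank_above_ok_def by auto
  qed
  also have "\<dots> = (\<Sum>X\<in>Pow A. of_nat (card {C \<in> bip_rels X. \<delta> C})) - (if A = {} then 1 else 0)"
  proof -
    have "(\<Sum>C\<in>bip_rels X. (if \<delta> C then 1 else 0) :: rat) = of_nat (card {C \<in> bip_rels X. \<delta> C})" if "X \<in> Pow A" for X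
      using sum_bip_indicator[of X \<delta> 1] that A by (auto intro: finite_subset)
    then show ?thesis by (cases "A = {}") (simp_all add: sum_subtractf)
  qed
  finally show ?thesis by simp
qed

text \<open>One step multiplies the column of the two states by the matrix with rows (e^x
  \<open>bip_gf\<close>, - \<open>full_gf\<close>) and (e^x \<open>full_gf\<close>, -
  \<open>full2_gf\<close>). The factor e^x accounts for isolated elements, the second column for the
  subtracted violations.\<close>

fun tail_gfs :: "nat \<Rightarrow> rat fps \<times> rat fps" where
  "tail_gfs 0 = (bip_gf * fps_exp 1 - 1, full_gf * fps_exp 1 - 1)"
| "tail_gfs (Suc h) = (let (T, T') = tail_gfs h in
     (bip_gf * (fps_exp 1 * T) - full_gf * T', full_gf * (fps_exp 1 * T) - full2_gf * T'))"

lemma has_egf_tail_sum: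
  "has_egf (tail_sum (\<lambda>_ :: 'a rel. True) h) (fst (tail_gfs h)) \<and>
   has_egf (tail_sum (full_tgt :: 'a rel \<Rightarrow> bool) h) (snd (tail_gfs h))"
proof (induction h)
  case 0
  show ?case
  proof (intro conjI; rule has_egf_cong)
    show "has_egf (\<lambda>A :: 'a set. (\<Sum>X\<in>Pow A. of_nat (card (bip_rels X)) * 1) - (if A = {} then 1 else 0))
        (bip_gf * fps_exp 1 - 1)"
      by (intro has_egf_diff has_egf_mult has_egf_bip has_egf_1 has_egf_empty)
    show "has_egf (\<lambda>A :: 'a set. (\<Sum>X\<in>Pow A. of_nat (card {C \<in> bip_rels X. full_tgt C}) * 1) - (if A = {} then 1 else 0))
        (full_gf * fps_exp 1 - 1)"
      by (intro has_egf_diff has_egf_mult has_egf_full_tgt has_egf_1 has_egf_empty)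
  qed (simp_all add: tail_sum_0)
next
  case (Suc h)
  obtain T T' where T: "tail_gfs h = (T, T')" by (cases "tail_gfs h")
  with Suc have h: "has_egf (tail_sum (\<lambda>_ :: 'a rel. True) h) T" "has_egf (tail_sum (full_tgt :: 'a rel \<Rightarrow> bool) h) T'"
    by auto
  show ?case
  proof (intro conjI; rule has_egf_cong)
    show "has_egf (\<lambda>A :: 'a set.
        (\<Sum>X\<in>Pow A. of_nat (card (bip_rels X)) * (\<Sum>B\<in>Pow (A - X). 1 * tail_sum (\<lambda>_. True) h (A - X - B))) -
        (\<Sum>X\<in>Pow A. of_nat (card {C \<in> bip_rels X. full_src C}) * tail_sum full_tgt h (A - X)))
        (bip_gf * (fps_exp 1 * T) - full_gf * T')"
      by (intro has_egf_diff has_egf_mult has_egf_bip has_egf_full_src has_egf_1 h)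
    show "has_egf (\<lambda>A :: 'a set.
        (\<Sum>X\<in>Pow A. of_nat (card {C \<in> bip_rels X. full_tgt C}) * (\<Sum>B\<in>Pow (A - X). 1 * tail_sum (\<lambda>_. True) h (A - X - B))) -
        (\<Sum>X\<in>Pow A. of_nat (card {C \<in> bip_rels X. full_src C \<and> full_tgt C}) * tail_sum full_tgt h (A - X)))
        (full_gf * (fps_exp 1 * T) - full2_gf * T')"
      by (intro has_egf_diff has_egf_mult has_egf_full_tgt has_egf_full_both has_egf_1 h)
  qed (simp_all add: tail_sum_Suc T conj_commute)
qed

text \<open>The index is shifted: \<open>tall_gf g\<close> belongs to height \<open>g + 3\<close>,
  with ranks up to \<open>g + 2\<close>. The bracket removes the configurations with empty bottom
  rank; both components of \<open>tail_gfs g\<close> enter because the empty piece has a full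
  source.\<close>

definition tall_gf :: "nat \<Rightarrow> rat fps" where
  "tall_gf g = fps_exp 1 * fst (tail_gfs (Suc g)) - (fps_exp 1 * fst (tail_gfs g) - snd (tail_gfs g))"

lemma has_egf_rank_structs:
  "has_egf (\<lambda>A :: 'a set. of_nat (card (rank_structs (Suc (Suc g)) (\<lambda>C. C \<noteq> {}) A))) (tall_gf g)"
proof (rule has_egf_cong)
  show "has_egf (\<lambda>A :: 'a set. (\<Sum>B\<in>Pow A. 1 * tail_sum (\<lambda>_. True) (Suc g) (A - B)) -
      ((\<Sum>B\<in>Pow A. 1 * tail_sum (\<lambda>_. True) g (A - B)) - tail_sum full_tgt g A)) (tall_gf g)"
    unfolding tall_gf_def
    by (intro has_egf_diff has_egf_mult has_egf_1 has_egf_tail_sum[THEN conjunct1] has_egf_tail_sum[THEN conjunct2])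
  fix A :: "'a set"
  assume A: "finite A"
  \<comment> \<open>Only the empty field carries the empty piece, so the violating configurations
    are structures with one rank fewer above an empty piece.\<close>
  have "tail_sum (\<lambda>C. C = {}) (Suc g) A = (\<Sum>X\<in>Pow A. if X = {} then
      of_nat (card (rank_structs (Suc g) (rank_above_ok (Suc g) {}) A)) else 0)"
    unfolding tail_sum_def
  proof (intro sum.cong refl)
    fix X assume "X \<in> Pow A"
    then have "finite X" using A by (auto intro: finite_subset)
    moreover have "C \<noteq> {}" if "C \<in> bip_rels X" "X \<noteq> {}" for C
      using that by (auto simp: bip_rels_def)
    ultimately show "(\<Sum>C\<in>bip_rels X. if C = {} then of_nat (card (rank_structs (Suc g) (rank_above_ok (Suc g) C) (A - X))) else 0)
        = (if X = {} then of_nat (card (rank_structs (Suc g) (rank_above_ok (Suc g) {}) A)) else (0 :: rat))"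
      by (cases "X = {}") (simp_all add: sum.neutral)
  qed
  also have "\<dots> = of_nat (card (rank_structs (Suc g) (rank_above_ok (Suc g) {}) A))"
    using A by simp
  finally show "of_nat (card (rank_structs (Suc (Suc g)) (\<lambda>C. C \<noteq> {}) A)) =
      (\<Sum>B\<in>Pow A. 1 * tail_sum (\<lambda>_. True) (Suc g) (A - B)) -
      ((\<Sum>B\<in>Pow A. 1 * tail_sum (\<lambda>_. True) g (A - B)) - tail_sum full_tgt g A)"
    unfolding rank_structs_Suc_tail_sum[OF A, of "Suc g"] rank_structs_rank_above_tail_sum[OF A] by simp
qed simp

section \<open>Ranked posets\<close>

locale fin_poset =
  fixes A :: "'a set" and r :: "'a rel"
  assumes finA: "finite A" and po: "partial_order_on A r"
begin

lemma r_sub: "r \<subseteq> A \<times> A"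
  using po by (auto simp: partial_order_on_def preorder_on_def)

lemma r_refl: "x \<in> A \<Longrightarrow> (x, x) \<in> r"
  using po by (auto simp: partial_order_on_def preorder_on_def refl_on_def)

lemma r_trans: "(x, y) \<in> r \<Longrightarrow> (y, z) \<in> r \<Longrightarrow> (x, z) \<in> r"
  using po by (auto simp: partial_order_on_def preorder_on_def dest: transD)

lemma r_antisym: "(x, y) \<in> r \<Longrightarrow> (y, x) \<in> r \<Longrightarrow> x = y"
  using po by (auto simp: partial_order_on_def dest: antisymD)

abbreviation lt :: "'a \<Rightarrow> 'a \<Rightarrow> bool" where "lt \<equiv> less_in r"

lemma lt_in: "lt x y \<Longrightarrow> x \<in> A \<and> y \<in> A"
  using r_sub by (auto simp: less_in_def)

lemma lt_trans: "lt x y \<Longrightarrow> lt y z \<Longrightarrow> lt x z"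
  using r_trans r_antisym by (metis less_in_def)

lemma le_lt_trans: "(x, y) \<in> r \<Longrightarrow> lt y z \<Longrightarrow> lt x z"
  using lt_trans by (metis less_in_def)

lemma lt_le_trans: "lt x y \<Longrightarrow> (y, z) \<in> r \<Longrightarrow> lt x z"
  using lt_trans by (metis less_in_def)

lemma lt_irrefl: "\<not> lt x x"
  by (simp add: less_in_def)

lemma finite_Chains: "finite (Chains r)"
  by (rule finite_subset[of _ "Pow A"]) (use r_sub finA in \<open>auto simp: Chains_def\<close>)

lemma Chains_sub: "K \<in> Chains r \<Longrightarrow> K \<subseteq> A"
  using r_sub by (auto simp: Chains_def)

lemma card_le_height: "K \<in> Chains r \<Longrightarrow> card K \<le> poset_height r"
  unfolding poset_height_def using finite_Chains by (intro Max_ge) auto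

lemma height_attained: "\<exists>K\<in>Chains r. card K = poset_height r"
proof -
  have "{} \<in> Chains r" by (simp add: Chains_def)
  then have "poset_height r \<in> card ` Chains r"
    unfolding poset_height_def using finite_Chains by (intro Max_in) auto
  then show ?thesis by auto
qed

lemma chain_card2: "K \<in> Chains r \<Longrightarrow> 2 \<le> card K \<Longrightarrow> \<exists>a b. lt a b"
proof -
  assume K: "K \<in> Chains r" "2 \<le> card K"
  then obtain T where "T \<subseteq> K" "card T = 2" by (metis obtain_subset_with_card_n)
  then obtain a b where "a \<in> K" "b \<in> K" "a \<noteq> b" by (auto simp: card_2_iff)
  with K(1) have "lt a b \<or> lt b a" by (auto simp: Chains_def less_in_def)
  then show ?thesis by blast
qed

lemma chain_card3: "K \<in> Chains r \<Longrightarrow> 3 \<le> card K \<Longrightarrow> \<exists>a b c. lt a b \<and> lt b c"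
proof -
  assume K: "K \<in> Chains r" "3 \<le> card K"
  then obtain T where "T \<subseteq> K" "card T = 3" by (metis obtain_subset_with_card_n)
  then obtain a b c where abc: "a \<in> K" "b \<in> K" "c \<in> K" "a \<noteq> b" "b \<noteq> c" "a \<noteq> c"
    by (auto simp: card_3_iff)
  have "lt x y \<or> lt y x" if "x \<in> K" "y \<in> K" "x \<noteq> y" for x y
    using that K(1) by (auto simp: Chains_def less_in_def)
  with abc show ?thesis by metis
qed

text \<open>Strong induction on the number of elements strictly between \<open>x\<close> and
  \<open>y\<close>: unless \<open>y\<close> covers \<open>x\<close>, an intermediate element splits
  the interval into two smaller ones. Claims about ranks are thereby reduced to covers.\<close>

lemma lt_induct [consumes 1, case_names cov step]:
  assumes "lt x y" and cov: "\<And>x y. covered_by r x y \<Longrightarrow> P x y"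
    and step: "\<And>x z y. lt x z \<Longrightarrow> lt z y \<Longrightarrow> P x z \<Longrightarrow> P z y \<Longrightarrow> P x y"
  shows "P x y"
  using \<open>lt x y\<close>
proof (induction "card {c. lt x c \<and> lt c y}" arbitrary: x y rule: less_induct)
  case less
  have fin: "finite {c. lt u c \<and> lt c v}" for u v
    by (rule finite_subset[OF _ finA]) (auto dest: lt_in)
  show ?case
  proof (cases "covered_by r x y")
    case False
    then obtain z where z: "lt x z" "lt z y"
      using less.prems by (auto simp: covered_by_def)
    have "{c. lt x c \<and> lt c z} \<subset> {c. lt x c \<and> lt c y}" "{c. lt z c \<and> lt c y} \<subset> {c. lt x c \<and> lt c y}"
      using z lt_trans lt_irrefl by blast+
    then have "P x z" "P z y"
      using z less.hyps psubset_card_mono[OF fin] by blast+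
    with z show ?thesis by (rule step)
  qed (rule cov)
qed

lemma lower_cover: "lt x y \<Longrightarrow> \<exists>z. covered_by r z y \<and> (x, z) \<in> r"
proof (induction rule: lt_induct)
  case (cov x y)
  then show ?case using r_refl lt_in by (metis covered_by_def)
next
  case (step x z y)
  then show ?case using r_trans by (metis less_in_def)
qed

lemma upper_cover: "lt x y \<Longrightarrow> \<exists>z. covered_by r x z \<and> (z, y) \<in> r"
proof (induction rule: lt_induct)
  case (cov x y)
  then show ?case using r_refl lt_in by (metis covered_by_def)
next
  case (step x z y)
  then show ?case using r_trans by (metis less_in_def)
qed

end

locale ranked_poset = fin_poset +
  fixes rk :: "'a \<Rightarrow> nat"
  assumes rk_cover: "covered_by r a b \<Longrightarrow> rk b = Suc (rk a)"
begin

lemma rk_less: "lt x y \<Longrightarrow> rk x < rk y"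
  by (induction rule: lt_induct) (auto simp: rk_cover)

lemma rk_le: "(x, y) \<in> r \<Longrightarrow> rk x \<le> rk y"
  using rk_less by (metis less_in_def less_imp_le order_refl)

lemma rk_inj_on_chain: "K \<in> Chains r \<Longrightarrow> inj_on rk K"
  unfolding inj_on_def Chains_def using rk_less by (fastforce simp: less_in_def)

text \<open>Covers raise the rank by exactly 1, so splicing chains skips no rank. This bounds the
  height from below and shows that all ranks between two comparable elements are occupied.\<close>

lemma saturated_chain:
  "lt x y \<Longrightarrow> \<exists>K\<in>Chains r. (\<forall>v\<in>K. (x, v) \<in> r \<and> (v, y) \<in> r) \<and> rk ` K = {rk x..rk y}"
proof (induction rule: lt_induct)
  case (cov x y)
  then have xy: "lt x y" "(x, y) \<in> r" "rk y = Suc (rk x)"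
    by (auto simp: rk_cover covered_by_def less_in_def)
  then have "(x, x) \<in> r" "(y, y) \<in> r" using lt_in r_refl by auto
  with xy show ?case
    by (intro bexI[of _ "{x, y}"]) (auto simp: Chains_def atLeastAtMostSuc_conv)
next
  case (step x z y)
  then obtain K K' where K: "K \<in> Chains r" "\<forall>v\<in>K. (x, v) \<in> r \<and> (v, z) \<in> r" "rk ` K = {rk x..rk z}"
    and K': "K' \<in> Chains r" "\<forall>v\<in>K'. (z, v) \<in> r \<and> (v, y) \<in> r" "rk ` K' = {rk z..rk y}"
    by blast
  have le: "rk x \<le> rk z" "rk z \<le> rk y" "(x, z) \<in> r" "(z, y) \<in> r"
    using step.hyps rk_less by (auto simp: less_in_def less_imp_le)
  have "(u, v) \<in> r" if "u \<in> K" "v \<in> K'" for u v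
    using that K(2) K'(2) r_trans by blast
  then have "K \<union> K' \<in> Chains r"
    using K(1) K'(1) by (auto simp: Chains_def)
  moreover have "rk ` (K \<union> K') = {rk x..rk y}"
    unfolding image_Un K(3) K'(3) using le by (simp add: ivl_disj_un_two_touch)
  moreover have "\<forall>v\<in>K \<union> K'. (x, v) \<in> r \<and> (v, y) \<in> r"
    using K(2) K'(2) le r_trans by blast
  ultimately show ?case by blast
qed

lemma height_eq:
  assumes "\<And>v. v \<in> A \<Longrightarrow> rk v \<le> h" "lt x y" "rk x = 0" "rk y = h"
  shows "poset_height r = Suc h"
proof (rule antisym)
  obtain K where K: "K \<in> Chains r" "card K = poset_height r"
    using height_attained by blast
  have "card K = card (rk ` K)"
    using rk_inj_on_chain[OF K(1)] by (simp add: card_image)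
  also have "\<dots> \<le> card {..h}"
    using assms(1) Chains_sub[OF K(1)] by (intro card_mono) auto
  finally show "poset_height r \<le> Suc h" by (simp add: K(2))
next
  obtain K where K: "K \<in> Chains r" "rk ` K = {0..h}"
    using saturated_chain[OF assms(2)] assms(3,4) by auto
  have "Suc h = card (rk ` K)" by (simp add: K(2))
  also have "\<dots> \<le> card K"
    using Chains_sub[OF K(1)] finA by (intro card_image_le) (auto intro: finite_subset)
  also have "\<dots> \<le> poset_height r" by (rule card_le_height[OF K(1)])
  finally show "Suc h \<le> poset_height r" .
qed

text \<open>Subtracting from \<open>rk\<close> its minimum on the component of each element
  preserves differences along covers, whose two ends share a component, and makes every component
  minimum 0. So any function that rises by 1 along covers can be normalised.\<close>

lemma weakly_graded: "weakly_graded A r"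
proof -
  define R where "R = (r \<union> r\<inverse>)\<^sup>+"
  have symR: "sym R" unfolding R_def by (intro sym_trancl) (auto simp: sym_def)
  have transR: "trans R" by (simp add: R_def)
  have R_sub: "R \<subseteq> A \<times> A"
    unfolding R_def using r_sub by (intro trancl_subset_Sigma) auto
  have eq: "R `` {u} = R `` {v}" if "(u, v) \<in> R" for u v
    using that symR transR by (auto dest: symD transD)
  define rk' where "rk' v = rk v - Min (rk ` (R `` {v}))" for v
  have fin: "finite (R `` {v})" for v
    by (rule finite_subset[OF _ finA]) (use R_sub in auto)
  have Min_le: "Min (rk ` (R `` {v})) \<le> rk v" if "v \<in> A" for v
    using that r_refl[of v] fin[of v] by (intro Min_le) (auto simp: R_def)
  show ?thesis
    unfolding weakly_graded_def
  proof (intro exI[of _ rk'] conjI ballI impI)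
    fix a b assume ab: "a \<in> A" "b \<in> A" "covered_by r a b"
    then have "(a, b) \<in> R"
      by (auto simp: R_def covered_by_def less_in_def)
    from eq[OF this] show "rk' b = rk' a + 1"
      using rk_cover[OF ab(3)] Min_le[OF ab(1)] by (simp add: rk'_def)
  next
    fix K assume "K \<in> poset_components A r"
    then obtain v where v: "v \<in> A" and K: "K = R `` {v}"
      by (auto simp: poset_components_def R_def quotient_def)
    have "(v, v) \<in> R" using r_refl[OF v] by (auto simp: R_def)
    then have ne: "rk ` K \<noteq> {}" "finite (rk ` K)" using fin by (auto simp: K)
    then obtain u where u: "u \<in> K" "Min (rk ` K) = rk u" by (metis Min_in imageE)
    have "rk' u = 0"
      using u eq[of v u] by (simp add: rk'_def K)
    moreover have "finite (rk' ` K)" using fin by (simp add: K)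
    moreover from calculation u(1) have "0 \<in> rk' ` K" by force
    ultimately show "Min (rk' ` K) = 0" by (intro Min_eqI) auto
  qed
qed

end

lemma weakly_graded_iff:
  fixes A :: "'a set"
  assumes "finite A" "partial_order_on A r"
  shows "weakly_graded A r \<longleftrightarrow> (\<exists>rk. ranked_poset A r rk)"
proof
  interpret fin_poset A r by standard (use assms in auto)
  assume "weakly_graded A r"
  then obtain rk :: "'a \<Rightarrow> nat" where "\<forall>a\<in>A. \<forall>b\<in>A. covered_by r a b \<longrightarrow> rk b = rk a + 1"
    by (auto simp: weakly_graded_def)
  then have "ranked_poset A r rk"
    by unfold_locales (auto simp: covered_by_def dest: lt_in)
  then show "\<exists>rk. ranked_poset A r rk" by blast
qed (auto intro: ranked_poset.weakly_graded)

section \<open>Consequences of avoidance in the presence of a three-element chain\<close>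

locale tall_poset = ranked_poset +
  fixes a b c :: 'a
  assumes avoiding: "three_plus_one_avoiding A r"
    and abc: "lt a b" "lt b c"
begin

lemma comparable_chain:
  "lt x y \<Longrightarrow> lt y z \<Longrightarrow> w \<in> A \<Longrightarrow> \<exists>u\<in>{x, y, z}. (w, u) \<in> r \<or> (u, w) \<in> r"
  using avoiding lt_in unfolding three_plus_one_avoiding_def incomparable_def by blast

lemma covering_abc: "\<exists>a c. lt a b \<and> lt b c \<and> rk b = Suc (rk a) \<and> rk c = Suc (rk b)"
  using lower_cover[OF abc(1)] upper_cover[OF abc(2)] rk_cover by (metis covered_by_def)

text \<open>Avoidance makes every element comparable with some member of any 3-chain. If
  \<open>y\<close> ended a 3-chain, two successive covers below \<open>y\<close> would form one with
  all ranks at least \<open>rk x\<close>, and comparability would put \<open>x\<close> below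
  \<open>y\<close>; dually \<open>x\<close> starts no 3-chain. Comparing both with a 3-chain of
  consecutive ranks around \<open>b\<close> forces \<open>rk y\<close> to be at most
  \<open>rk b\<close> and \<open>rk x\<close> at least \<open>rk b\<close>, against the gap.\<close>

lemma rk_gap_imp_lt:
  assumes x: "x \<in> A" and y: "y \<in> A" and gap: "rk x + 2 \<le> rk y"
  shows "lt x y"
proof (rule ccontr)
  assume nlt: "\<not> lt x y"
  have "x \<noteq> y" using gap by auto
  with nlt have nle: "(x, y) \<notin> r" by (auto simp: less_in_def)
  have low: False if z: "lt z' z" "lt z y" for z z'
  proof -
    obtain z0 where z0: "covered_by r z0 y" "(z, z0) \<in> r" using lower_cover z(2) by blast
    then have "lt z' z0" using z(1) lt_le_trans by blast
    then obtain z1 where z1: "covered_by r z1 z0" using lower_cover by blast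
    have l: "lt z1 z0" "lt z0 y" using z0 z1 by (auto simp: covered_by_def)
    have rks: "rk y = Suc (rk z0)" "rk z0 = Suc (rk z1)" using z0 z1 rk_cover by auto
    from comparable_chain[OF l x] obtain u where u: "u \<in> {z1, z0, y}" "(x, u) \<in> r \<or> (u, x) \<in> r" by blast
    have "(u, y) \<in> r" using u(1) l lt_trans[OF l] r_refl[OF y] by (auto simp: less_in_def)
    moreover have "x = u" if "(u, x) \<in> r"
    proof (rule ccontr)
      assume "x \<noteq> u"
      with that have "rk u < rk x" by (intro rk_less) (auto simp: less_in_def)
      then show False using u(1) rks gap by auto
    qed
    ultimately have "(x, y) \<in> r" using u(2) r_trans by blast
    then show False using nle by blast
  qed
  have up: False if z: "lt x z" "lt z z'" for z z'
  proof -
    obtain z0 where z0: "covered_by r x z0" "(z0, z) \<in> r" using upper_cover z(1) by blast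
    then have "lt z0 z'" using z(2) le_lt_trans by blast
    then obtain z1 where z1: "covered_by r z0 z1" using upper_cover by blast
    have l: "lt x z0" "lt z0 z1" using z0 z1 by (auto simp: covered_by_def)
    have rks: "rk z0 = Suc (rk x)" "rk z1 = Suc (rk z0)" using z0 z1 rk_cover by auto
    from comparable_chain[OF l y] obtain u where u: "u \<in> {x, z0, z1}" "(y, u) \<in> r \<or> (u, y) \<in> r" by blast
    have "(x, u) \<in> r" using u(1) l lt_trans[OF l] r_refl[OF x] by (auto simp: less_in_def)
    moreover have "y = u" if "(y, u) \<in> r"
    proof (rule ccontr)
      assume "y \<noteq> u"
      with that have "rk y < rk u" by (intro rk_less) (auto simp: less_in_def)
      then show False using u(1) rks gap by auto
    qed
    ultimately have "(x, y) \<in> r" using u(2) r_trans by blast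
    then show False using nle by blast
  qed
  obtain a c where ac: "lt a b" "lt b c" "rk b = Suc (rk a)" "rk c = Suc (rk b)"
    using covering_abc by blast
  have "rk y \<le> rk b"
  proof -
    from comparable_chain[OF ac(1,2) y] consider "(y, b) \<in> r" | "(y, a) \<in> r" | "(y, c) \<in> r" "y \<noteq> c"
      | "lt a y" | "lt b y" | "(c, y) \<in> r"
      by (auto simp: less_in_def)
    then show ?thesis
    proof cases
      case 1
      then show ?thesis by (rule rk_le)
    next
      case 2
      then show ?thesis using rk_le[of y a] ac(3) by simp
    next
      case 3
      then show ?thesis using rk_less[of y c] ac(4) by (simp add: less_in_def)
    next
      case 4
      \<comment> \<open>An element strictly between \<open>a\<close> and \<open>y\<close> would
        complete a 3-chain ending at \<open>y\<close>; so \<open>y\<close> covers \<open>a\<close>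
        and shares the rank of \<open>b\<close>.\<close>
      then have "covered_by r a y" using low by (auto simp: covered_by_def)
      then show ?thesis using rk_cover ac by simp
    next
      case 5
      then show ?thesis using low ac(1) by blast
    next
      case 6
      then show ?thesis using low ac(1) lt_le_trans[OF ac(2)] by blast
    qed
  qed
  moreover have "rk b \<le> rk x"
  proof -
    from comparable_chain[OF ac(1,2) x] consider "(b, x) \<in> r" | "(c, x) \<in> r" | "(a, x) \<in> r" "a \<noteq> x"
      | "lt x c" | "lt x b" | "(x, a) \<in> r"
      by (auto simp: less_in_def)
    then show ?thesis
    proof cases
      case 1
      then show ?thesis by (rule rk_le)
    next
      case 2
      then show ?thesis using rk_le[of c x] ac(4) by simp
    next
      case 3
      then show ?thesis using rk_less[of a x] ac(3) by (simp add: less_in_def)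
    next
      case 4
      then have "covered_by r x c" using up by (auto simp: covered_by_def)
      then show ?thesis using rk_cover ac by simp
    next
      case 5
      then show ?thesis using up ac(2) by blast
    next
      case 6
      then show ?thesis using up ac(2) le_lt_trans[OF _ ac(1)] by blast
    qed
  qed
  ultimately show False using gap by simp
qed

end

section \<open>Posets of height at least 3\<close>

definition wg_posets_on :: "'a set \<Rightarrow> nat \<Rightarrow> 'a rel set" where
  "wg_posets_on A k = {r. partial_order_on A r \<and> weakly_graded A r \<and>
     three_plus_one_avoiding A r \<and> poset_height r = k}"

definition struct_rel :: "'a set \<Rightarrow> ('a \<Rightarrow> nat) \<Rightarrow> 'a rel \<Rightarrow> 'a rel" where
  "struct_rel A rk C = {(x, y) \<in> A \<times> A. x = y \<or> rk x + 2 \<le> rk y \<or> (rk y = Suc (rk x) \<and> (x, y) \<notin> C)}"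

lemma levels_ok_Suc_unfolded:
  "levels_ok (Suc h) \<gamma> b L \<longleftrightarrow> (b 0 \<or> \<gamma> (L 0)) \<and>
     (\<forall>i<h. b (Suc i) \<or> \<not> full_src (L i) \<or> \<not> full_tgt (L (Suc i))) \<and> (b (Suc h) \<or> L h \<noteq> {})"
proof -
  have "(\<forall>j\<le>h. b (Suc j) \<or> rank_above_ok (h - j) (L j) (L (Suc j))) \<longleftrightarrow>
     (\<forall>i<h. b (Suc i) \<or> \<not> full_src (L i) \<or> \<not> full_tgt (L (Suc i))) \<and> (b (Suc h) \<or> L h \<noteq> {})"
    by (auto simp: rank_above_ok_def le_less)
  then show ?thesis
    unfolding levels_ok_def all_le_Suc_iff by simp
qed

section \<open>From rank structures to posets\<close>

locale rank_struct =
  fixes A :: "'a set" and h :: nat and rk :: "'a \<Rightarrow> nat" and C :: "'a rel"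
  assumes finA: "finite A" and h: "h \<ge> 2" and rs: "(rk, C) \<in> rank_structs h (\<lambda>C. C \<noteq> {}) A"
begin

lemma rk_PiE: "rk \<in> A \<rightarrow>\<^sub>E {..h}"
  and C_sub: "C \<subseteq> A \<times> A"
  and C_bip: "Domain C \<inter> Range C = {}"
  and C_rk: "(x, y) \<in> C \<Longrightarrow> rk y = Suc (rk x)"
  using rs by (auto simp: rank_structs_def)

lemma rk_bound: "x \<in> A \<Longrightarrow> rk x \<le> h"
  using rk_PiE by auto

lemma levels: "levels_ok h (\<lambda>C. C \<noteq> {}) (\<lambda>j. \<exists>v\<in>A - Field C. rk v = j) (level rk C)"
  using rs by (auto simp: rank_structs_def)

lemma bottom: "\<exists>v\<in>A. rk v = 0"
proof -
  obtain h' where "h = Suc h'" using h by (cases h) auto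
  with levels have "(\<exists>v\<in>A - Field C. rk v = 0) \<or> level rk C 0 \<noteq> {}"
    by (simp add: levels_ok_Suc_unfolded)
  then show ?thesis using C_sub by (fastforce simp: level_def)
qed

lemma top: "\<exists>v\<in>A. rk v = h"
proof -
  obtain h' where h': "h = Suc h'" using h by (cases h) auto
  with levels have "(\<exists>v\<in>A - Field C. rk v = h) \<or> level rk C h' \<noteq> {}"
    by (simp add: levels_ok_Suc_unfolded)
  then show ?thesis using C_sub C_rk h' by (fastforce simp: level_def)
qed

lemma middle:
  assumes "Suc i < h"
  shows "(\<exists>v\<in>A - Field C. rk v = Suc i) \<or> \<not> full_src (level rk C i) \<or> \<not> full_tgt (level rk C (Suc i))"
proof -
  obtain h' where h': "h = Suc h'" using h by (cases h) auto
  with levels assms show ?thesis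
    by (simp add: levels_ok_Suc_unfolded)
qed

text \<open>An isolated element of the middle rank is related to both ends. If \<open>x\<close> is
  not joined to all targets, a target \<open>y\<close> missed by \<open>x\<close> works: as a target
  it starts no pair of \<open>C\<close>, so it is below \<open>z\<close>. The third case is
  dual.\<close>

lemma between:
  assumes x: "x \<in> A" and z: "z \<in> A" and i: "rk x = i" "rk z = i + 2"
  shows "\<exists>y\<in>A. rk y = Suc i \<and> (x, y) \<notin> C \<and> (y, z) \<notin> C"
proof -
  have "Suc i < h" using rk_bound[OF z] i by simp
  from middle[OF this] consider v where "v \<in> A" "v \<notin> Field C" "rk v = Suc i"
    | "\<not> full_src (level rk C i)" | "\<not> full_tgt (level rk C (Suc i))" by blast
  then show ?thesis
  proof cases
    case 1
    then show ?thesis by (intro bexI[of _ v]) (auto simp: Field_def)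
  next
    case 2
    then have "\<not> Range (level rk C i) \<subseteq> level rk C i `` {x}"
      by (auto simp: full_src_def)
    then obtain u y where uy: "(u, y) \<in> level rk C i" "(x, y) \<notin> level rk C i"
      by auto
    then have "(u, y) \<in> C" "(x, y) \<notin> C" "rk y = Suc i" using i C_rk[of u y] by (auto simp: level_def)
    then show ?thesis using C_bip C_sub by (intro bexI[of _ y]) auto
  next
    case 3
    then have "\<not> Domain (level rk C (Suc i)) \<subseteq> (level rk C (Suc i))\<inverse> `` {z}"
      by (auto simp: full_tgt_def)
    then obtain u y where uy: "(y, u) \<in> level rk C (Suc i)" "(y, z) \<notin> level rk C (Suc i)"
      by auto
    then have "(y, u) \<in> C" "(y, z) \<notin> C" "rk y = Suc i" by (auto simp: level_def)
    then show ?thesis using C_bip C_sub by (intro bexI[of _ y]) auto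
  qed
qed

text \<open>For an interior rank each of the three alternatives produces an element: a piece that
  fails to be full is nonempty, since the empty piece is full.\<close>

lemma level_nonempty:
  assumes "j \<le> h"
  shows "\<exists>v\<in>A. rk v = j"
proof (cases "j = 0 \<or> j = h")
  case True
  then show ?thesis using bottom top by blast
next
  case False
  then obtain i where i: "j = Suc i" "Suc i < h" using assms by (cases j) auto
  have "Range (level rk C i) \<noteq> {}" if "\<not> full_src (level rk C i)"
    using that by (auto simp: full_src_def)
  moreover have "Domain (level rk C (Suc i)) \<noteq> {}" if "\<not> full_tgt (level rk C (Suc i))"
    using that by (auto simp: full_tgt_def)
  ultimately consider v where "v \<in> A" "rk v = Suc i" | u v where "(u, v) \<in> level rk C i"
    | u v where "(v, u) \<in> level rk C (Suc i)"
    using middle[OF i(2)] by blast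
  then show ?thesis
  proof cases
    case 2
    then show ?thesis using C_rk[of u v] C_sub i by (auto simp: level_def)
  next
    case 3
    then show ?thesis using C_sub i by (auto simp: level_def)
  qed (use i in auto)
qed

abbreviation r :: "'a rel" where "r \<equiv> struct_rel A rk C"

lemma less_in_r: "less_in r x y \<longleftrightarrow>
    x \<in> A \<and> y \<in> A \<and> (rk x + 2 \<le> rk y \<or> (rk y = Suc (rk x) \<and> (x, y) \<notin> C))"
  by (auto simp: less_in_def struct_rel_def)

text \<open>Transitivity is automatic: two strict steps raise the rank by at least 2, and such a gap
  always means being related.\<close>

lemma partial_order: "partial_order_on A r"
  unfolding partial_order_on_def preorder_on_def
  by (auto simp: struct_rel_def refl_on_def trans_def antisym_def)

sublocale ranked_poset A r rk
proof unfold_locales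
  fix x z assume xz: "covered_by r x z"
  then have lt: "less_in r x z" and no: "\<And>y. less_in r x y \<Longrightarrow> \<not> less_in r y z"
    by (auto simp: covered_by_def)
  show "rk z = Suc (rk x)"
  proof (rule ccontr)
    assume "rk z \<noteq> Suc (rk x)"
    with lt have A: "x \<in> A" "z \<in> A" and gap: "rk x + 2 \<le> rk z"
      by (auto simp: less_in_r)
    have "rk x + 2 \<le> h" using gap rk_bound[OF A(2)] by simp
    then obtain v where v: "v \<in> A" "rk v = rk x + 2" using level_nonempty by blast
    show False
    proof (cases "rk z = rk x + 2")
      case True
      with between[OF A refl] obtain y where "y \<in> A" "rk y = Suc (rk x)" "(x, y) \<notin> C" "(y, z) \<notin> C"
        by blast
      then show False using no[of y] A True by (auto simp: less_in_r)
    next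
      case False
      \<comment> \<open>The element \<open>v\<close> serves to obtain some \<open>y\<close> above
        \<open>x\<close> in the next rank; as \<open>z\<close> is at least three ranks above
        \<open>x\<close>, the rank gap alone puts \<open>y\<close> below \<open>z\<close>.\<close>
      from between[OF A(1) v(1) refl v(2)] obtain y where "y \<in> A" "rk y = Suc (rk x)" "(x, y) \<notin> C"
        by blast
      then show False using no[of y] A False gap by (auto simp: less_in_r)
    qed
  qed
qed (use finA partial_order in auto)

text \<open>The ranks of \<open>x\<close> and \<open>z\<close> differ by at least 2. An element
  incomparable to both must lie exactly one rank above \<open>x\<close> and one below
  \<open>z\<close>, and would then be a target and a source of \<open>C\<close> at once.\<close>

lemma avoiding: "three_plus_one_avoiding A r"
  unfolding three_plus_one_avoiding_def
proof clarify
  fix x y z w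
  assume "x \<in> A" "y \<in> A" "z \<in> A" "w \<in> A" and xyz: "less_in r x y" "less_in r y z"
    and inc: "incomparable r w x" "incomparable r w y" "incomparable r w z"
  have nw: "\<not> rk u + 2 \<le> rk v" "rk v = Suc (rk u) \<Longrightarrow> (u, v) \<in> C"
    if "incomparable r u v \<or> incomparable r v u" "u \<in> A" "v \<in> A" for u v
    using that by (auto simp: incomparable_def struct_rel_def)
  have "rk z \<ge> rk x + 2" using rk_less[OF xyz(1)] rk_less[OF xyz(2)] by simp
  moreover have "rk w \<le> rk x + 1" "rk z \<le> rk w + 1"
    using nw(1)[of x w] nw(1)[of w z] inc \<open>x \<in> A\<close> \<open>z \<in> A\<close> \<open>w \<in> A\<close> by auto
  ultimately have "rk w = Suc (rk x)" "rk z = Suc (rk w)" by auto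
  then have "(x, w) \<in> C" "(w, z) \<in> C"
    using nw(2)[of x w] nw(2)[of w z] inc \<open>x \<in> A\<close> \<open>z \<in> A\<close> \<open>w \<in> A\<close> by auto
  then show False using C_bip by auto
qed

lemma bottom_top: "x \<in> A \<Longrightarrow> z \<in> A \<Longrightarrow> rk x = 0 \<Longrightarrow> rk z = h \<Longrightarrow> less_in r x z"
  using h by (simp add: less_in_r)

lemma height: "poset_height r = Suc h"
proof -
  obtain x z where "x \<in> A" "z \<in> A" "rk x = 0" "rk z = h" using bottom top by blast
  then show ?thesis using height_eq rk_bound bottom_top by blast
qed

lemma struct_rel_in: "r \<in> wg_posets_on A (Suc h)"
  using partial_order weakly_graded avoiding height by (simp add: wg_posets_on_def)

text \<open>Comparable elements fix the difference of their ranks, and every element is equal or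
  comparable to a bottom element \<open>x\<close> or a top element \<open>z\<close>, which are
  comparable to each other. Only \<open>h = 2\<close> with \<open>v\<close> in the middle is not
  settled by a rank gap: there \<open>v\<close> is not both a source and a target, so it is related
  to \<open>x\<close> or to \<open>z\<close>.\<close>

lemma rank_unique:
  assumes rp: "ranked_poset A r rk'"
  obtains d :: int where "\<And>v. v \<in> A \<Longrightarrow> int (rk' v) = int (rk v) + d"
proof -
  obtain x z where xz: "x \<in> A" "z \<in> A" "rk x = 0" "rk z = h" using bottom top by blast
  note lt_xz = bottom_top[OF xz]
  have diff: "int (rk' v) - int (rk v) = int (rk' u) - int (rk u)" if "less_in r u v" for u v
    using that
  proof (induction rule: lt_induct)
    case (cov u v)
    then show ?case using rk_cover ranked_poset.rk_cover[OF rp] by simp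
  qed simp
  have "int (rk' v) = int (rk v) + (int (rk' x) - int (rk x))" if v: "v \<in> A" for v
  proof -
    have "v = x \<or> v = z \<or> less_in r x v \<or> less_in r v z"
    proof (cases "rk v + 2 \<le> h")
      case True
      then show ?thesis using xz v by (auto simp: less_in_r)
    next
      case False
      then consider "rk v \<ge> 2" | "rk v = 1" "h = 2"
        using rk_bound[OF v] h by linarith
      then show ?thesis
      proof cases
        case 1
        then show ?thesis using xz v by (auto simp: less_in_r)
      next
        case 2
        have "v \<notin> Range C \<or> v \<notin> Domain C" using C_bip by auto
        then show ?thesis using 2 xz v by (auto simp: less_in_r)
      qed
    qed
    then show ?thesis using diff[OF lt_xz] diff[of x v] diff[of v z] by auto
  qed
  then show ?thesis by (rule that)
qed

end

lemma struct_rel_inj: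
  assumes "finite A" "h \<ge> 2"
  shows "inj_on (\<lambda>(rk, C). struct_rel A rk C) (rank_structs h (\<lambda>C. C \<noteq> {}) A)"
proof (rule inj_onI, clarify)
  fix rk C rk' C'
  assume *: "(rk, C) \<in> rank_structs h (\<lambda>C. C \<noteq> {}) A" "(rk', C') \<in> rank_structs h (\<lambda>C. C \<noteq> {}) A"
    and eq: "struct_rel A rk C = struct_rel A rk' C'"
  interpret S: rank_struct A h rk C by standard (use assms * in auto)
  interpret S': rank_struct A h rk' C' by standard (use assms * in auto)
  have "ranked_poset A S.r rk'" unfolding eq by (rule S'.ranked_poset_axioms)
  then obtain d where d: "\<And>v. v \<in> A \<Longrightarrow> int (rk' v) = int (rk v) + d"
    using S.rank_unique by blast
  obtain x x' where x: "x \<in> A" "rk x = 0" "x' \<in> A" "rk' x' = 0"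
    using S.bottom S'.bottom by blast
  \<comment> \<open>Both rank functions are nonnegative and attain 0, which bounds the shift from
    both sides.\<close>
  have "d = 0" using d[of x] d[of x'] x by linarith
  then have rk: "rk v = rk' v" if "v \<in> A" for v using d[OF that] by simp
  have "rk = rk'"
    by (rule extensionalityI[of _ A]) (use S.rk_PiE S'.rk_PiE rk in \<open>auto simp: PiE_iff\<close>)
  moreover have "C = C'"
  proof -
    have "(x, y) \<in> C \<longleftrightarrow> x \<in> A \<and> y \<in> A \<and> rk y = Suc (rk x) \<and> (x, y) \<notin> struct_rel A rk C" for x y
      using S.C_sub S.C_rk[of x y] by (auto simp: struct_rel_def)
    moreover have "(x, y) \<in> C' \<longleftrightarrow> x \<in> A \<and> y \<in> A \<and> rk' y = Suc (rk' x) \<and> (x, y) \<notin> struct_rel A rk' C'" for x y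
      using S'.C_sub S'.C_rk[of x y] by (auto simp: struct_rel_def)
    ultimately have "(x, y) \<in> C \<longleftrightarrow> (x, y) \<in> C'" for x y
      using eq \<open>rk = rk'\<close> by simp
    then show ?thesis by auto
  qed
  ultimately show "rk = rk' \<and> C = C'" by simp
qed

section \<open>From posets to rank structures\<close>

lemma tall_poset_exists:
  assumes A: "finite A" and h: "h \<ge> 2" and r: "r \<in> wg_posets_on A (Suc h)"
  obtains rk a b c x where "tall_poset A r rk a b c" "rk \<in> extensional A" "x \<in> A" "rk x = 0"
proof -
  from r have po: "partial_order_on A r" and wg: "weakly_graded A r"
    and av: "three_plus_one_avoiding A r" and ht: "poset_height r = Suc h"
    by (auto simp: wg_posets_on_def)
  obtain rk0 where rk0: "ranked_poset A r rk0"
    using wg weakly_graded_iff[OF A po] by blast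
  then interpret ranked_poset A r rk0 .
  obtain K where "K \<in> Chains r" "3 \<le> card K"
    using height_attained ht h by auto
  then obtain a b c where abc: "lt a b" "lt b c"
    using chain_card3 by blast
  \<comment> \<open>Shifting by the global minimum keeps differences and makes the value 0 occur;
    restricting to \<open>A\<close> gives the extensional form used in
    \<open>rank_structs\<close>.\<close>
  define m where "m = Min (rk0 ` A)"
  define rk where "rk = (\<lambda>v\<in>A. rk0 v - m)"
  have m: "m \<le> rk0 v" if "v \<in> A" for v
    using that A by (simp add: m_def)
  have ne: "A \<noteq> {}" using lt_in[OF abc(1)] by auto
  have "tall_poset A r rk a b c"
  proof unfold_locales
    fix x y assume "covered_by r x y"
    moreover from this have "x \<in> A" "y \<in> A" by (auto simp: covered_by_def dest: lt_in)
    ultimately show "rk y = Suc (rk x)"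
      using rk_cover m[of x] by (simp add: rk_def)
  qed (use av abc in auto)
  moreover have "m \<in> rk0 ` A" unfolding m_def using A ne by (intro Min_in) auto
  then have "\<exists>x\<in>A. rk x = 0" by (auto simp: rk_def)
  ultimately show ?thesis using that by (auto simp: rk_def)
qed

lemma struct_rel_surj:
  assumes A: "finite A" and h: "h \<ge> 2" and r: "r \<in> wg_posets_on A (Suc h)"
  shows "\<exists>(rk, C)\<in>rank_structs h (\<lambda>C. C \<noteq> {}) A. struct_rel A rk C = r"
proof -
  obtain rk a b c x0 where tall: "tall_poset A r rk a b c" and ext: "rk \<in> extensional A"
    and x0: "x0 \<in> A" "rk x0 = 0"
    using tall_poset_exists[OF A h r] .
  interpret tall_poset A r rk a b c by (rule tall)
  have ht: "poset_height r = Suc h" using r by (simp add: wg_posets_on_def)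
  have ne: "A \<noteq> {}" using x0 by auto
  define H where "H = Max (rk ` A)"
  have H_ge: "rk v \<le> H" if "v \<in> A" for v
    using that A by (simp add: H_def)
  obtain z0 where z0: "z0 \<in> A" "rk z0 = H"
  proof -
    have "H \<in> rk ` A" unfolding H_def using A ne by (intro Max_in) auto
    then show ?thesis using that by auto
  qed
  have "H \<ge> 2"
    using rk_less[OF abc(1)] rk_less[OF abc(2)] H_ge[of c] lt_in[OF abc(2)] by simp
  then have lt0: "lt x0 z0"
    using x0 z0 by (intro rk_gap_imp_lt) auto
  have H: "H = h"
    using height_eq[OF H_ge lt0 x0(2) z0(2)] ht by simp
  have ranks: "\<exists>v\<in>A. rk v = j" if j: "j \<le> h" for j
  proof -
    obtain K where K: "K \<in> Chains r" "rk ` K = {0..H}"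
      using saturated_chain[OF lt0] x0 z0 by auto
    have "j \<in> rk ` K" using K(2) H j by simp
    then show ?thesis using Chains_sub[OF K(1)] by auto
  qed
  define C where "C = {(x, y) \<in> A \<times> A. rk y = Suc (rk x) \<and> (x, y) \<notin> r}"
  have eq: "struct_rel A rk C = r"
  proof -
    have "(x, y) \<in> struct_rel A rk C \<longleftrightarrow> (x, y) \<in> r" for x y
    proof
      assume "(x, y) \<in> struct_rel A rk C"
      then have "x \<in> A" "y \<in> A" and "x = y \<or> rk x + 2 \<le> rk y \<or> (rk y = Suc (rk x) \<and> (x, y) \<notin> C)"
        by (auto simp: struct_rel_def)
      then show "(x, y) \<in> r"
        using r_refl[of x] rk_gap_imp_lt[of x y] by (auto simp: C_def less_in_def)
    next
      assume xy: "(x, y) \<in> r"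
      then have "x \<in> A" "y \<in> A" using r_sub by auto
      moreover have "x = y \<or> rk x < rk y" using rk_less[of x y] xy by (auto simp: less_in_def)
      ultimately show "(x, y) \<in> struct_rel A rk C"
        using xy by (auto simp: struct_rel_def C_def)
    qed
    then show ?thesis by auto
  qed
  \<comment> \<open>A path \<open>x\<close>, \<open>v\<close>, \<open>z\<close> in \<open>C\<close>
    gives the forbidden pattern: the rank gap yields \<open>x < z\<close>, some \<open>y\<close>
    lies strictly between them, and \<open>v\<close> is incomparable to \<open>x\<close>,
    \<open>y\<close> and \<open>z\<close>.\<close>
  have bip_rels: "Domain C \<inter> Range C = {}"
  proof (rule ccontr)
    assume "Domain C \<inter> Range C \<noteq> {}"
    then obtain x v z where xv: "(x, v) \<in> C" and vz: "(v, z) \<in> C" by auto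
    then have A': "x \<in> A" "v \<in> A" "z \<in> A" and rks: "rk v = Suc (rk x)" "rk z = Suc (rk v)"
      and nr: "(x, v) \<notin> r" "(v, z) \<notin> r"
      by (auto simp: C_def)
    have "lt x z" using A' rks by (intro rk_gap_imp_lt) auto
    then obtain y where y: "covered_by r x y" "(y, z) \<in> r" using upper_cover by blast
    then have rky: "rk y = Suc (rk x)" by (simp add: rk_cover)
    then have l: "lt x y" "lt y z" using y rks by (auto simp: covered_by_def less_in_def)
    from comparable_chain[OF l A'(2)] obtain u where u: "u \<in> {x, y, z}" "(v, u) \<in> r \<or> (u, v) \<in> r" by blast
    have "v \<noteq> y" using l nr by (auto simp: less_in_def)
    then have "(v, y) \<notin> r" "(y, v) \<notin> r"
      using rk_less[of v y] rk_less[of y v] rks rky by (auto simp: less_in_def)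
    moreover have "(v, x) \<notin> r" "(z, v) \<notin> r"
      using rk_le[of v x] rk_le[of z v] rks by auto
    ultimately show False using u nr by auto
  qed
  have Csub: "C \<subseteq> A \<times> A" and C_rk: "(x, y) \<in> C \<Longrightarrow> rk y = Suc (rk x)" for x y
    by (auto simp: C_def)
  obtain h' where h': "h = Suc h'" using h by (cases h) auto
  have "levels_ok h (\<lambda>C. C \<noteq> {}) (\<lambda>j. \<exists>v\<in>A - Field C. rk v = j) (level rk C)"
    unfolding h' levels_ok_Suc_unfolded
  proof (intro conjI allI impI)
    show "(\<exists>v\<in>A - Field C. rk v = 0) \<or> level rk C 0 \<noteq> {}"
    proof (cases "x0 \<in> Field C")
      case True
      moreover have "x0 \<notin> Range C" using C_rk x0 by fastforce
      ultimately show ?thesis using x0 by (auto simp: Field_def level_def)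
    qed (use x0 in auto)
    show "(\<exists>v\<in>A - Field C. rk v = Suc h') \<or> level rk C h' \<noteq> {}"
    proof (cases "z0 \<in> Field C")
      case True
      moreover have "z0 \<notin> Domain C" using C_rk z0 H_ge Csub by fastforce
      ultimately obtain y where "(y, z0) \<in> C" by (auto simp: Field_def)
      then show ?thesis using C_rk[of y z0] z0 H h' by (auto simp: level_def)
    qed (use z0 H h' in auto)
  next
    fix i assume i: "i < h'"
    show "(\<exists>v\<in>A - Field C. rk v = Suc i) \<or> \<not> full_src (level rk C i) \<or> \<not> full_tgt (level rk C (Suc i))"
    proof (rule ccontr)
      assume "\<not> ?thesis"
      then have free: "\<And>v. v \<in> A \<Longrightarrow> rk v = Suc i \<Longrightarrow> v \<in> Field C"
        and src: "full_src (level rk C i)" and tgt: "full_tgt (level rk C (Suc i))" by auto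
      \<comment> \<open>Fullness provides \<open>x\<close> and \<open>z\<close> on the two sides of
        the rank, joined by \<open>C\<close> to all its targets and to all its sources respectively;
        for an empty piece any element of the outer rank serves. An intermediate \<open>y\<close>
        between \<open>x\<close> and \<open>z\<close> is not isolated, so it is such a target or
        source, contradicting \<open>x < y < z\<close>.\<close>
      have "\<exists>x\<in>A. rk x = i \<and> Range (level rk C i) \<subseteq> level rk C i `` {x}"
      proof (cases "level rk C i = {}")
        case True
        then show ?thesis using ranks[of i] i h' by auto
      next
        case False
        then obtain u w where uw: "(u, w) \<in> level rk C i" by auto
        obtain x where x: "Range (level rk C i) \<subseteq> level rk C i `` {x}"
          using src by (auto simp: full_src_def)
        then have "(x, w) \<in> level rk C i" using uw by auto
        then show ?thesis using x Csub by (intro bexI[of _ x]) (auto simp: level_def)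
      qed
      then obtain x where x: "x \<in> A" "rk x = i" "Range (level rk C i) \<subseteq> level rk C i `` {x}" by blast
      have "\<exists>z\<in>A. rk z = i + 2 \<and> Domain (level rk C (Suc i)) \<subseteq> (level rk C (Suc i))\<inverse> `` {z}"
      proof (cases "level rk C (Suc i) = {}")
        case True
        then show ?thesis using ranks[of "i + 2"] i h' by auto
      next
        case False
        then obtain u w where uw: "(w, u) \<in> level rk C (Suc i)" by auto
        obtain z where z: "Domain (level rk C (Suc i)) \<subseteq> (level rk C (Suc i))\<inverse> `` {z}"
          using tgt by (auto simp: full_tgt_def)
        then have "(w, z) \<in> level rk C (Suc i)" using uw by auto
        then have "(w, z) \<in> C" "rk w = Suc i" by (auto simp: level_def)
        then show ?thesis using z Csub C_rk[of w z] by (intro bexI[of _ z]) auto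
      qed
      then obtain z where z: "z \<in> A" "rk z = i + 2"
        "Domain (level rk C (Suc i)) \<subseteq> (level rk C (Suc i))\<inverse> `` {z}" by blast
      have "lt x z" using x z by (intro rk_gap_imp_lt) auto
      then obtain y where y: "covered_by r x y" "(y, z) \<in> r" using upper_cover by blast
      then have rky: "rk y = Suc i" and xy: "(x, y) \<in> r" and yA: "y \<in> A"
        using x r_sub by (auto simp: rk_cover covered_by_def less_in_def)
      from free[OF yA rky] consider u where "(u, y) \<in> C" | u where "(y, u) \<in> C"
        by (auto simp: Field_def)
      then show False
      proof cases
        case 1
        then have "(u, y) \<in> level rk C i" using C_rk[of u y] rky by (auto simp: level_def)
        then have "(x, y) \<in> C" using x(3) by (auto simp: level_def)
        then show False using xy by (auto simp: C_def)
      next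
        case 2
        then have "(y, u) \<in> level rk C (Suc i)" using rky by (auto simp: level_def)
        then have "(y, z) \<in> C" using z(3) by (auto simp: level_def)
        then show False using y(2) by (auto simp: C_def)
      qed
    qed
  qed
  then have "(rk, C) \<in> rank_structs h (\<lambda>C. C \<noteq> {}) A"
    using bip_rels Csub C_rk H_ge H ext by (auto simp: rank_structs_def PiE_iff)
  with eq show ?thesis by blast
qed

lemma card_wg_posets_on_tall:
  assumes "finite A" "h \<ge> 2"
  shows "card (wg_posets_on A (Suc h)) = card (rank_structs h (\<lambda>C. C \<noteq> {}) A)"
proof -
  have "(\<lambda>(rk, C). struct_rel A rk C) ` rank_structs h (\<lambda>C. C \<noteq> {}) A = wg_posets_on A (Suc h)"
  proof (intro equalityI subsetI)
    fix r assume "r \<in> (\<lambda>(rk, C). struct_rel A rk C) ` rank_structs h (\<lambda>C. C \<noteq> {}) A"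
    then obtain rk C where r: "r = struct_rel A rk C" "(rk, C) \<in> rank_structs h (\<lambda>C. C \<noteq> {}) A" by auto
    then interpret rank_struct A h rk C by unfold_locales (use assms in auto)
    show "r \<in> wg_posets_on A (Suc h)" unfolding r(1) by (rule struct_rel_in)
  next
    fix r assume "r \<in> wg_posets_on A (Suc h)"
    from struct_rel_surj[OF assms this] show "r \<in> (\<lambda>(rk, C). struct_rel A rk C) ` rank_structs h (\<lambda>C. C \<noteq> {}) A"
      by force
  qed
  then show ?thesis using card_image[OF struct_rel_inj[OF assms]] by simp
qed

section \<open>Posets of height at most 2\<close>

text \<open>Without paths in \<open>C\<close>, adding the diagonal already gives a transitive
  relation, every strict pair is a cover, and rank 1 on the targets is a grading. Avoidance holds
  because there is no 3-chain.\<close>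

lemma flat_in_wg_posets_on:
  assumes A: "finite A" and C: "C \<subseteq> A \<times> A" "Domain C \<inter> Range C = {}"
  shows "C \<union> Id_on A \<in> wg_posets_on A (if C \<noteq> {} then 2 else if A \<noteq> {} then 1 else 0)"
proof -
  let ?r = "C \<union> Id_on A"
  have less: "less_in ?r x y \<longleftrightarrow> (x, y) \<in> C" for x y
    using C by (auto simp: less_in_def)
  have no_path: "\<not> (less_in ?r x y \<and> less_in ?r y z)" for x y z
    unfolding less using C by auto
  have po: "partial_order_on A ?r"
    unfolding partial_order_on_def preorder_on_def refl_on_def trans_def antisym_def
    using C by auto
  interpret ranked_poset A ?r "\<lambda>v. if v \<in> Range C then 1 else 0"
    by unfold_locales (use A po C less in \<open>auto simp: covered_by_def\<close>)
  obtain K where K: "K \<in> Chains ?r" "card K = poset_height ?r"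
    using height_attained by blast
  have "poset_height ?r = (if C \<noteq> {} then 2 else if A \<noteq> {} then 1 else 0)"
  proof (cases "C = {}")
    case False
    then obtain x y where xy: "(x, y) \<in> C" by auto
    then have "{x, y} \<in> Chains ?r" "x \<noteq> y" using C by (auto simp: Chains_def)
    then have "2 \<le> poset_height ?r" using card_le_height[of "{x, y}"] by simp
    moreover have "poset_height ?r < 3"
      using chain_card3[OF K(1)] no_path K(2) by (cases "3 \<le> card K") auto
    ultimately show ?thesis using False by simp
  next
    case True
    have "poset_height ?r < 2"
      using chain_card2[OF K(1)] less True K(2) by (cases "2 \<le> card K") auto
    moreover have "1 \<le> poset_height ?r" if "A \<noteq> {}"
    proof -
      from that obtain x where "x \<in> A" by auto
      then have "{x} \<in> Chains ?r" by (auto simp: Chains_def)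
      then show ?thesis using card_le_height[of "{x}"] by simp
    qed
    moreover have "poset_height ?r = 0" if "A = {}"
      using Chains_sub[OF K(1)] that K(2) by simp
    ultimately show ?thesis using True by (cases "A = {}") simp_all
  qed
  moreover have "three_plus_one_avoiding A ?r"
    unfolding three_plus_one_avoiding_def using no_path by blast
  ultimately show ?thesis
    using po weakly_graded by (simp add: wg_posets_on_def)
qed

lemma card_wg_posets_on_low:
  assumes A: "finite A" and k: "k \<le> 2"
  shows "card (wg_posets_on A k) = card {C. C \<subseteq> A \<times> A \<and> Domain C \<inter> Range C = {} \<and>
     k = (if C \<noteq> {} then 2 else if A \<noteq> {} then 1 else 0)}"
    (is "_ = card ?S")
proof -
  have "wg_posets_on A k = (\<lambda>C. C \<union> Id_on A) ` ?S"
  proof (intro equalityI subsetI)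
    fix r assume "r \<in> (\<lambda>C. C \<union> Id_on A) ` ?S"
    then obtain C where "r = C \<union> Id_on A" "C \<subseteq> A \<times> A" "Domain C \<inter> Range C = {}"
      "k = (if C \<noteq> {} then 2 else if A \<noteq> {} then 1 else 0)" by blast
    then show "r \<in> wg_posets_on A k" using flat_in_wg_posets_on[OF A, of C] by simp
  next
    fix r assume r: "r \<in> wg_posets_on A k"
    then interpret fin_poset A r by unfold_locales (use A in \<open>auto simp: wg_posets_on_def\<close>)
    define C where "C = r - Id"
    have eq: "r = C \<union> Id_on A" using r_refl r_sub by (auto simp: C_def)
    have C: "C \<subseteq> A \<times> A" using r_sub by (auto simp: C_def)
    have "Domain C \<inter> Range C = {}"
    proof (rule ccontr)
      assume "Domain C \<inter> Range C \<noteq> {}"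
      then obtain x y z where "(x, y) \<in> C" "(y, z) \<in> C" by auto
      then have xyz: "lt x y" "lt y z"
        by (auto simp: C_def less_in_def)
      with lt_trans have "lt x z" by blast
      with xyz have "{x, y, z} \<in> Chains r" "card {x, y, z} = 3"
        using lt_in[of x y] lt_in[of y z] r_refl by (auto simp: Chains_def less_in_def)
      then show False using card_le_height r k by (fastforce simp: wg_posets_on_def)
    qed
    moreover have "k = (if C \<noteq> {} then 2 else if A \<noteq> {} then 1 else 0)"
      using flat_in_wg_posets_on[OF A C calculation] r unfolding eq[symmetric] by (auto simp: wg_posets_on_def)
    ultimately show "r \<in> (\<lambda>C. C \<union> Id_on A) ` ?S"
      using eq C by blast
  qed
  moreover have "inj_on (\<lambda>C. C \<union> Id_on A) ?S"
  proof (rule inj_onI)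
    fix C C' assume *: "C \<in> ?S" "C' \<in> ?S" "C \<union> Id_on A = C' \<union> Id_on A"
    have "C = (C \<union> Id_on A) - Id" "C' = (C' \<union> Id_on A) - Id" using *(1,2) by auto
    with *(3) show "C = C'" by simp
  qed
  ultimately show ?thesis by (simp add: card_image)
qed

lemma card_flat:
  assumes A: "finite A"
  shows "card {C. C \<subseteq> A \<times> A \<and> Domain C \<inter> Range C = {}} = (\<Sum>X\<in>Pow A. card (bip_rels X))"
proof -
  have "{C. C \<subseteq> A \<times> A \<and> Domain C \<inter> Range C = {}} = (\<Union>X\<in>Pow A. bip_rels X)"
    by (auto simp: bip_rels_def Field_def)
  moreover have "card (\<Union>X\<in>Pow A. bip_rels X) = (\<Sum>X\<in>Pow A. card (bip_rels X))"
  proof (rule card_UN_disjoint)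
    show "\<forall>X\<in>Pow A. finite (bip_rels X)"
      using A by (auto intro!: finite_bip intro: finite_subset)
  qed (use A in \<open>auto simp: bip_rels_def\<close>)
  ultimately show ?thesis by simp
qed

text \<open>For height 2, \<open>bip_gf * fps_exp 1\<close> counts all relations without paths, the
  isolated points being chosen freely, and e^x removes the empty relation on each set.\<close>

fun height_gf :: "nat \<Rightarrow> rat fps" where
  "height_gf 0 = 1"
| "height_gf (Suc 0) = fps_exp 1 - 1"
| "height_gf (Suc (Suc 0)) = bip_gf * fps_exp 1 - fps_exp 1"
| "height_gf (Suc (Suc (Suc g))) = tall_gf g"

lemma has_egf_wg_posets_on: "has_egf (\<lambda>A :: 'a set. of_nat (card (wg_posets_on A k))) (height_gf k)"
proof (cases k rule: height_gf.cases)
  case 1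
  show ?thesis
  proof (rule has_egf_cong[OF _ has_egf_empty])
    fix A :: "'a set"
    assume A: "finite A"
    have "{C. C \<subseteq> A \<times> A \<and> Domain C \<inter> Range C = {} \<and>
       0 = (if C \<noteq> {} then 2 else if A \<noteq> {} then 1 else (0 :: nat))} = (if A = {} then {{}} else {})"
      by auto
    then show "of_nat (card (wg_posets_on A k)) = (if A = {} then 1 else (0 :: rat))"
      using card_wg_posets_on_low[OF A, of 0] 1 by simp
  qed (simp add: 1)
next
  case 2
  have "of_nat (card (wg_posets_on A 1)) = 1 - (if A = {} then 1 else 0 :: rat)" if "finite A" for A :: "'a set"
  proof -
    have "{C. C \<subseteq> A \<times> A \<and> Domain C \<inter> Range C = {} \<and>
       1 = (if C \<noteq> {} then 2 else if A \<noteq> {} then 1 else (0 :: nat))} = (if A = {} then {} else {{}})"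
      by auto
    then show ?thesis using card_wg_posets_on_low[OF that, of 1] by simp
  qed
  then show ?thesis
    by (intro has_egf_cong[OF _ has_egf_diff[OF has_egf_1 has_egf_empty]]) (auto simp: 2)
next
  case 3
  show ?thesis
  proof (rule has_egf_cong[OF _ has_egf_diff[OF has_egf_mult[OF has_egf_bip has_egf_1] has_egf_1]])
    fix A :: "'a set"
    assume A: "finite A"
    let ?F = "{C. C \<subseteq> A \<times> A \<and> Domain C \<inter> Range C = {}}"
    have "{C. C \<subseteq> A \<times> A \<and> Domain C \<inter> Range C = {} \<and>
       2 = (if C \<noteq> {} then 2 else if A \<noteq> {} then 1 else (0 :: nat))} = ?F - {{}}"
      by auto
    then have c1: "card (wg_posets_on A 2) = card (?F - {{}})"
      using card_wg_posets_on_low[OF A, of 2] by simp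
    have "finite ?F"
      by (rule finite_subset[of _ "Pow (A \<times> A)"]) (use A in auto)
    then have c2: "card ?F = Suc (card (?F - {{}}))"
      by (intro card.remove) auto
    have "of_nat (card (wg_posets_on A 2)) = (of_nat (card ?F) - 1 :: rat)"
      unfolding c1 c2 of_nat_Suc by (rule add_diff_cancel_left'[symmetric])
    moreover have "k = 2" by (simp add: 3)
    ultimately show "of_nat (card (wg_posets_on A k)) = (\<Sum>S\<in>Pow A. of_nat (card (bip_rels S)) * 1) - (1 :: rat)"
      by (simp only: card_flat[OF A] of_nat_sum mult_1_right)
  qed (simp add: 3)
next
  case (4 g)
  show ?thesis
    by (rule has_egf_cong[OF _ has_egf_rank_structs[of g]]) (simp_all add: 4 card_wg_posets_on_tall)
qed

lemma wg_count_height_gf: "of_nat (wg_count n k) / fact n = fps_nth (height_gf k) n"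
proof -
  have "wg_count n k = card (wg_posets_on {1..n} k)"
    by (simp add: wg_count_def wg_posets_def wg_posets_on_def)
  then show ?thesis
    using has_egfD[OF has_egf_wg_posets_on, of "{1..n}" k] by simp
qed

section \<open>Closed forms\<close>

text \<open>The trace of the transfer matrix; \<open>rec_b\<close> is minus its determinant.\<close>

definition rec_a :: "rat fps" where "rec_a = fps_exp 1 * bip_gf - full2_gf"
definition rec_b :: "rat fps" where "rec_b = fps_exp 1 * (bip_gf * full2_gf - full_gf\<^sup>2)"

text \<open>Cayley-Hamilton: \<open>tall_gf g\<close> is a fixed linear function of the state
  \<open>tail_gfs g\<close>, and the states are iterates of one 2 by 2 matrix. The identity is
  checked with variables in place of the series, \<open>U\<close> and \<open>V\<close> being the
  components of the states.\<close>

lemma tall_gf_rec: "tall_gf (Suc (Suc g)) = rec_a * tall_gf (Suc g) + rec_b * tall_gf g"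
proof -
  obtain T T' where T: "tail_gfs g = (T, T')" by (cases "tail_gfs g")
  have ring: "E * (p * (E * (p * (E * U1) - q * V1)) - q * (q * (E * U1) - s * V1)) -
      (E * (p * (E * U1) - q * V1) - (q * (E * U1) - s * V1)) =
    (E * p - s) * (E * (p * (E * U1) - q * V1) - (E * U1 - V1)) +
    (E * (p * s - q\<^sup>2)) * (E * U1 - (E * U0 - V0))"
    if "U1 = p * (E * U0) - q * V0" "V1 = q * (E * U0) - s * V0" for E p q s U0 V0 U1 V1 :: "rat fps"
    unfolding that by (simp add: algebra_simps power2_eq_square)
  show ?thesis
    unfolding tall_gf_def rec_a_def rec_b_def tail_gfs.simps T Let_def prod.case fst_conv snd_conv
    by (rule ring[OF refl refl])
qed

lemma exp_inverse: "fps_exp (- 1) * fps_exp 1 = (1 :: rat fps)"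
  and exp_2: "fps_exp (2 :: rat) = (fps_exp 1)\<^sup>2"
  and exp_3: "fps_exp (3 :: rat) = (fps_exp 1) ^ 3"
  by (simp_all add: fps_exp_power_mult flip: fps_exp_add_mult)

lemma Psi_eq: "Psi = (fps_exp 1)\<^sup>2 * bip_gf"
proof -
  have "fps_exp 2 * fps_exp (- 2) = (1 :: rat fps)"
    by (simp flip: fps_exp_add_mult)
  then show ?thesis unfolding bip_gf_def exp_2[symmetric] mult.assoc[symmetric] by simp
qed

text \<open>The closed forms access \<open>full_gf\<close> through this relation, which replaces
  e^(-x) by a polynomial expression in e^x and \<open>bip_gf\<close>.\<close>

lemma full_gf_exp: "full_gf * fps_exp 1 = 1 + (fps_exp 1 - 1) * fps_exp 1 * bip_gf"
  unfolding full_gf_def distrib_right exp_inverse by (simp add: mult_ac)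

text \<open>The factor e^(2x) absorbs \<open>bip_gf\<close> into \<open>Psi\<close>. This identity
  and the one for \<open>rec_b\<close> give the denominator of the theorem, those for
  \<open>tall_gf\<close> its numerator.\<close>

lemma rec_a_eq: "(fps_exp 1)\<^sup>2 * rec_a = - ((fps_exp 1)\<^sup>2 + (1 - 3 * fps_exp 1 + fps_exp 2) * Psi)"
proof -
  have "E\<^sup>2 * (E * p - (1 + (E - 1)\<^sup>2 * p)) = - (E\<^sup>2 + (1 - 3 * E + E\<^sup>2) * (E\<^sup>2 * p))" for E p :: "rat fps"
    by (simp add: algebra_simps power2_eq_square)
  then show ?thesis
    unfolding rec_a_def full2_gf_def Psi_eq exp_2 .
qed

lemma rec_b_eq: "(fps_exp 1)\<^sup>2 * rec_b = - (fps_exp 1 + (fps_exp 1 - 2) * Psi)"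
proof -
  have ring: "E\<^sup>2 * (E * (p * (1 + (E - 1)\<^sup>2 * p) - q\<^sup>2)) = - (E + (E - 2) * (E\<^sup>2 * p))"
    if u: "q * E = 1 + (E - 1) * E * p" for E p q :: "rat fps"
  proof -
    have "E\<^sup>2 * (E * (p * (1 + (E - 1)\<^sup>2 * p) - q\<^sup>2)) = E * (E\<^sup>2 * p * (1 + (E - 1)\<^sup>2 * p) - (q * E)\<^sup>2)"
      by (simp add: algebra_simps power2_eq_square)
    then show ?thesis
      unfolding u by (simp add: algebra_simps power2_eq_square)
  qed
  show ?thesis
    unfolding rec_b_def full2_gf_def Psi_eq by (rule ring[OF full_gf_exp])
qed

lemma tall_gf_0:
  "(fps_exp 1)\<^sup>2 * tall_gf 0 = fps_exp 3 - 2 * (fps_exp 1)\<^sup>2 * Psi - (1 - 3 * fps_exp 1 + fps_exp 2) * Psi\<^sup>2"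
proof -
  have ring: "E\<^sup>2 * (E * (p * (E * (p * E - 1)) - q * (q * E - 1)) - (E * (p * E - 1) - (q * E - 1))) =
      E ^ 3 - 2 * E\<^sup>2 * (E\<^sup>2 * p) - (1 - 3 * E + E\<^sup>2) * (E\<^sup>2 * p)\<^sup>2"
    if u: "q * E = 1 + (E - 1) * E * p" for E p q :: "rat fps"
  proof -
    have "E\<^sup>2 * (E * (p * (E * (p * E - 1)) - q * (q * E - 1)) - (E * (p * E - 1) - (q * E - 1))) =
        E\<^sup>2 * (E * (p * (E * (p * E - 1))) - (q * E) * (q * E - 1) - (E * (p * E - 1) - (q * E - 1)))"
      by (simp add: algebra_simps)
    then show ?thesis
      unfolding u by (simp add: algebra_simps power2_eq_square power3_eq_cube)
  qed
  show ?thesis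
    unfolding tall_gf_def Psi_eq exp_2 exp_3 tail_gfs.simps Let_def prod.case fst_conv snd_conv
    by (rule ring[OF full_gf_exp])
qed

text \<open>The left side, up to e^(2x), is the coefficient of t that remains in the numerator when
  the recurrence becomes a rational function.\<close>

lemma tall_gf_1: "(fps_exp 1)\<^sup>2 * (tall_gf (Suc 0) - rec_a * tall_gf 0) =
    fps_exp 3 - fps_exp 1 * (1 + 2 * fps_exp 1 - fps_exp 2) * Psi - (fps_exp 1 - 2) * Psi\<^sup>2"
proof -
  have ring: "E\<^sup>2 * (E * (p * (E * U1) - q * V1) - (E * U1 - V1) -
        (E * p - (1 + (E - 1)\<^sup>2 * p)) * (E * U1 - (E * (p * E - 1) - (q * E - 1)))) =
      E ^ 3 - E * (1 + 2 * E - E\<^sup>2) * (E\<^sup>2 * p) - (E - 2) * (E\<^sup>2 * p)\<^sup>2"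
    if u: "q * E = 1 + (E - 1) * E * p"
      and U: "U1 = p * (E * (p * E - 1)) - q * (q * E - 1)"
      and V: "V1 = q * (E * (p * E - 1)) - (1 + (E - 1)\<^sup>2 * p) * (q * E - 1)"
    for E p q U1 V1 :: "rat fps"
  proof -
    have U': "E * U1 = E * p * (E * (p * E - 1)) - (q * E) * (q * E - 1)"
      unfolding U by (simp add: algebra_simps)
    have V': "V1 = (q * E) * (p * E - 1) - (1 + (E - 1)\<^sup>2 * p) * (q * E - 1)"
      unfolding V by (simp add: algebra_simps)
    have "E\<^sup>2 * (E * (p * (E * U1) - q * V1) - (E * U1 - V1) -
        (E * p - (1 + (E - 1)\<^sup>2 * p)) * (E * U1 - (E * (p * E - 1) - (q * E - 1)))) =
      E\<^sup>2 * (E * p * (E * U1) - (q * E) * V1 - (E * U1 - V1) -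
        (E * p - (1 + (E - 1)\<^sup>2 * p)) * (E * U1 - (E * (p * E - 1) - (q * E - 1))))"
      by (simp add: algebra_simps)
    then show ?thesis
      unfolding U' V' u by (simp add: algebra_simps power2_eq_square power3_eq_cube)
  qed
  show ?thesis
    unfolding tall_gf_def Psi_eq exp_2 exp_3 rec_a_def full2_gf_def tail_gfs.simps Let_def prod.case fst_conv snd_conv
    by (rule ring[OF full_gf_exp refl refl])
qed

section \<open>Series in two variables\<close>

lemma in_x_0: "in_x 0 = 0"
  and in_x_1: "in_x 1 = 1"
  and in_x_add: "in_x (f + g) = in_x f + in_x g"
  and in_x_diff: "in_x (f - g) = in_x f - in_x g"
  and in_x_minus: "in_x (- f) = - in_x f"
  by (simp_all add: in_x_def fps_eq_iff fps_const_add[symmetric] del: fps_const_add)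

lemma in_x_mult: "in_x (f * g) = in_x f * in_x g"
proof (intro fps_ext)
  fix n k
  have "fps_nth (fps_nth (in_x f * in_x g) n) k =
      (\<Sum>i=0..n. fps_nth (fps_const (fps_nth f i) * fps_const (fps_nth g (n - i))) k)"
    unfolding fps_mult_nth[of "in_x f"] fps_sum_nth by (simp add: in_x_def)
  then show "fps_nth (fps_nth (in_x (f * g)) n) k = fps_nth (fps_nth (in_x f * in_x g) n) k"
    by (simp add: in_x_def fps_mult_nth[of f])
qed

lemma in_x_power: "in_x (f ^ k) = in_x f ^ k"
  by (induction k) (simp_all add: in_x_1 in_x_mult)

lemma in_x_numeral: "in_x (numeral m) = numeral m"
proof -
  have "in_x (of_nat n) = of_nat n" for n
    by (induction n) (simp_all add: in_x_0 in_x_1 in_x_add)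
  from this[of "numeral m"] show ?thesis by simp
qed

lemmas in_x_hom = in_x_0 in_x_1 in_x_add in_x_diff in_x_minus in_x_mult in_x_power in_x_numeral

definition gf2 :: "(nat \<Rightarrow> rat fps) \<Rightarrow> rat fps fps" where
  "gf2 W = Abs_fps (\<lambda>n. Abs_fps (\<lambda>k. fps_nth (W k) n))"

lemma gf2_add: "gf2 (\<lambda>k. V k + W k) = gf2 V + gf2 W"
  by (simp add: gf2_def fps_eq_iff)

lemma gf2_mult: "gf2 (\<lambda>k. f * W k) = in_x f * gf2 W"
proof (intro fps_ext)
  fix n k
  have "fps_nth (fps_nth (in_x f * gf2 W) n) k =
      (\<Sum>i=0..n. fps_nth (fps_const (fps_nth f i) * Abs_fps (\<lambda>k. fps_nth (W k) (n - i))) k)"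
    unfolding fps_mult_nth[of "in_x f"] fps_sum_nth by (simp add: in_x_def gf2_def)
  then show "fps_nth (fps_nth (gf2 (\<lambda>k. f * W k)) n) k = fps_nth (fps_nth (in_x f * gf2 W) n) k"
    by (simp add: gf2_def fps_mult_nth[of f])
qed

lemma gf2_Suc: "gf2 W = in_x (W 0) + t_var * gf2 (\<lambda>k. W (Suc k))"
proof (intro fps_ext)
  fix n k
  show "fps_nth (fps_nth (gf2 W) n) k = fps_nth (fps_nth (in_x (W 0) + t_var * gf2 (\<lambda>k. W (Suc k))) n) k"
    by (cases k) (simp_all add: gf2_def in_x_def t_var_def)
qed

lemma w_gf2_eq: "w_gf2 = gf2 height_gf"
  by (simp add: w_gf2_def gf2_def wg_count_height_gf)

lemma tall_gf2:
  "(1 - in_x rec_a * t_var - in_x rec_b * t_var\<^sup>2) * gf2 tall_gf =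
    in_x (tall_gf 0) + in_x (tall_gf (Suc 0) - rec_a * tall_gf 0) * t_var"
proof -
  let ?G1 = "gf2 (\<lambda>g. tall_gf (Suc g))" and ?G2 = "gf2 (\<lambda>g. tall_gf (Suc (Suc g)))"
  have G2: "?G2 = in_x rec_a * ?G1 + in_x rec_b * gf2 tall_gf"
    unfolding tall_gf_rec gf2_add gf2_mult ..
  have ring: "(1 - a * t - b * t\<^sup>2) * G = g0 + (g1 - a * g0) * t"
    if "G = g0 + t * G1" "G1 = g1 + t * G2" "G2 = a * G1 + b * G" for a b t G G1 G2 g0 g1 :: "rat fps fps"
  proof -
    have "t * G1 = G - g0" using that(1) by simp
    moreover have "t * (t * G2) = t * G1 - t * g1" using that(2) by (simp add: algebra_simps)
    moreover have "t * (t * G2) = a * (t * (t * G1)) + b * (t * (t * G))"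
      unfolding that(3) by (simp add: algebra_simps)
    ultimately have "G - g0 - t * g1 = a * (t * (G - g0)) + b * (t * (t * G))" by simp
    then show ?thesis by (simp add: algebra_simps power2_eq_square)
  qed
  show ?thesis
    unfolding in_x_diff in_x_mult by (rule ring[OF gf2_Suc gf2_Suc G2])
qed

section \<open>Setting t = 1\<close>

lemma height_gf_nth_eq_0: "n < k \<Longrightarrow> fps_nth (height_gf k) n = 0"
  using wg_count_height_gf[of n k] wg_count_eq_0[of n k] by simp

lemma tall_gf_nth_eq_0: "n < g + 3 \<Longrightarrow> fps_nth (tall_gf g) n = 0"
  using height_gf_nth_eq_0[of n "Suc (Suc (Suc g))"] by simp

text \<open>A series in t has no value at 1 in general, so the sum over heights is formed
  coefficientwise. Stopping at \<open>g \<le> n\<close> is harmless because \<open>tall_gf g\<close>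
  has no terms below x^(g + 3).\<close>

definition tall_sum :: "rat fps" where
  "tall_sum = Abs_fps (\<lambda>n. \<Sum>g\<le>n. fps_nth (tall_gf g) n)"

lemma tall_sum_nth:
  assumes "n \<le> K"
  shows "fps_nth (\<Sum>g\<le>K. tall_gf g) n = fps_nth tall_sum n"
  unfolding tall_sum_def fps_nth_Abs_fps fps_sum_nth
  using assms by (intro sum.mono_neutral_right) (auto intro: tall_gf_nth_eq_0)

lemma tall_sum_eq:
  "(1 - rec_a - rec_b) * tall_sum = tall_gf 0 + (tall_gf (Suc 0) - rec_a * tall_gf 0)"
proof -
  have "tall_sum - tall_gf 0 - tall_gf (Suc 0) = rec_a * (tall_sum - tall_gf 0) + rec_b * tall_sum"
  proof (rule fps_ext)
    fix n
    define S where "S K = (\<Sum>g\<le>K. tall_gf g)" for K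
    \<comment> \<open>The coefficient of x^n in a product involves only coefficients up to n, where
      a long enough partial sum agrees with \<open>tall_sum\<close>; so partial sums of different
      lengths can all be replaced by it.\<close>
    have mult: "fps_nth (f * S K) n = fps_nth (f * tall_sum) n" if "n \<le> K" for f K
      unfolding fps_mult_nth using that by (intro sum.cong refl) (auto simp: S_def tall_sum_nth)
    have S1: "(\<Sum>g\<le>K. tall_gf (Suc g)) = S (Suc K) - tall_gf 0" for K
      unfolding S_def sum.atMost_Suc_shift by simp
    have "(\<Sum>g\<le>n. tall_gf (Suc (Suc g))) = S (Suc (Suc n)) - tall_gf 0 - tall_gf (Suc 0)"
      unfolding S_def sum.atMost_Suc_shift by simp
    moreover have "(\<Sum>g\<le>n. tall_gf (Suc (Suc g))) = rec_a * (S (Suc n) - tall_gf 0) + rec_b * S n"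
      unfolding tall_gf_rec sum.distrib sum_distrib_left[symmetric] S1 by (simp add: S_def)
    ultimately have "S (Suc (Suc n)) - tall_gf 0 - tall_gf (Suc 0) = rec_a * (S (Suc n) - tall_gf 0) + rec_b * S n"
      by simp
    from arg_cong[OF this, of "\<lambda>f. fps_nth f n"]
    show "fps_nth (tall_sum - tall_gf 0 - tall_gf (Suc 0)) n =
        fps_nth (rec_a * (tall_sum - tall_gf 0) + rec_b * tall_sum) n"
      using mult[of n rec_b] mult[of "Suc n" rec_a] tall_sum_nth[of n "Suc (Suc n)"]
      by (simp add: right_diff_distrib S_def)
  qed
  then show ?thesis by (simp add: algebra_simps)
qed

text \<open>The series for heights 0, 1 and 2 add up to e^x \<open>bip_gf\<close>, since 1 and e^x
  cancel.\<close>

lemma w_gf_eq: "w_gf = fps_exp 1 * bip_gf + tall_sum"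
proof (rule fps_ext)
  fix n
  have "fps_nth w_gf n = (\<Sum>k\<le>n. fps_nth (height_gf k) n)"
    by (simp add: w_gf_def wg_total_def sum_divide_distrib wg_count_height_gf)
  also have "\<dots> = (\<Sum>k\<le>Suc (Suc (Suc n)). fps_nth (height_gf k) n)"
    by (intro sum.mono_neutral_left) (auto intro: height_gf_nth_eq_0)
  also have "\<dots> = fps_nth (fps_exp 1 * bip_gf + tall_sum) n"
    unfolding sum.atMost_Suc_shift by (simp add: tall_sum_def mult.commute)
  finally show "fps_nth w_gf n = fps_nth (fps_exp 1 * bip_gf + tall_sum) n" .
qed

lemma exp_bip_gf: "fps_exp 1 * bip_gf = fps_exp (- 1) * Psi"
proof -
  have "fps_exp (- 1) * (fps_exp 1)\<^sup>2 = (fps_exp 1 :: rat fps)"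
    unfolding power2_eq_square mult.assoc[symmetric] exp_inverse by simp
  then show ?thesis unfolding Psi_eq mult.assoc[symmetric] by simp
qed

theorem theorem8p3:
  shows
    "w_gf2 =
      (let e = in_x (fps_exp 1); P = in_x Psi; t = t_var in
        1 + (e - 1) * t + (in_x (fps_exp (-1)) * P - e) * t ^ 2 +
        t ^ 3 *
          ((in_x (fps_exp 3) + in_x (fps_exp 3) * t
             - e * (2 * e + (1 + 2 * e - in_x (fps_exp 2)) * t) * P
             - ((1 - 3 * e + in_x (fps_exp 2)) + (e - 2) * t) * P ^ 2) /
           (e * (e + t * e + t ^ 2)
             + ((1 - 3 * e + in_x (fps_exp 2)) * t + (e - 2) * t ^ 2) * P)))
    \<and>
    w_gf =
      (let e = fps_exp 1 in
        (fps_exp (-1) - 1) * Psi +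
        (2 * fps_exp 3 + fps_exp 2 * (e - 2) * Psi) /
        (e * (2 * e + 1) + (fps_exp 2 - 2 * e - 1) * Psi))"
proof (intro conjI)
  define e where "e = in_x (fps_exp 1)"
  define P where "P = in_x Psi"
  define t where "t = t_var"
  define e2 where "e2 = in_x (fps_exp 2)"
  define e3 where "e3 = in_x (fps_exp 3)"
  define D where "D = e * (e + t * e + t ^ 2) + ((1 - 3 * e + e2) * t + (e - 2) * t ^ 2) * P"
  define N where "N = e3 + e3 * t - e * (2 * e + (1 + 2 * e - e2) * t) * P -
      ((1 - 3 * e + e2) + (e - 2) * t) * P ^ 2"
  note in_x_defs = e_def[symmetric] P_def[symmetric] e2_def[symmetric] e3_def[symmetric]
  have a: "e\<^sup>2 * in_x rec_a = - (e\<^sup>2 + (1 - 3 * e + e2) * P)"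
    using arg_cong[OF rec_a_eq, of in_x] unfolding in_x_hom in_x_defs .
  have b: "e\<^sup>2 * in_x rec_b = - (e + (e - 2) * P)"
    using arg_cong[OF rec_b_eq, of in_x] unfolding in_x_hom in_x_defs .
  have g0: "e\<^sup>2 * in_x (tall_gf 0) = e3 - 2 * e\<^sup>2 * P - (1 - 3 * e + e2) * P\<^sup>2"
    using arg_cong[OF tall_gf_0, of in_x] unfolding in_x_hom in_x_defs .
  have g1: "e\<^sup>2 * in_x (tall_gf (Suc 0) - rec_a * tall_gf 0) =
      e3 - e * (1 + 2 * e - e2) * P - (e - 2) * P\<^sup>2"
    using arg_cong[OF tall_gf_1, of in_x] unfolding in_x_hom in_x_defs .
  \<comment> \<open>The denominator is 1 - trace t + determinant t^2 of the transfer matrix, scaled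
    by e^(2x).\<close>
  have D: "D = e\<^sup>2 * (1 - in_x rec_a * t - in_x rec_b * t\<^sup>2)"
  proof -
    have "e\<^sup>2 * (1 - in_x rec_a * t - in_x rec_b * t\<^sup>2) =
        e\<^sup>2 - (e\<^sup>2 * in_x rec_a) * t - (e\<^sup>2 * in_x rec_b) * t\<^sup>2"
      by (simp add: algebra_simps)
    then show ?thesis
      unfolding a b D_def by (simp add: algebra_simps power2_eq_square)
  qed
  have "D * gf2 tall_gf = (e\<^sup>2 * in_x (tall_gf 0)) +
      (e\<^sup>2 * in_x (tall_gf (Suc 0) - rec_a * tall_gf 0)) * t"
    unfolding D mult.assoc t_def tall_gf2 by (simp add: algebra_simps)
  then have DF: "D * gf2 tall_gf = N"
    unfolding g0 g1 N_def by (simp add: algebra_simps power2_eq_square)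
  have D0: "fps_nth D 0 = 1"
    using denominator_const_coeff unfolding D_def e_def P_def t_def e2_def .
  then have "N / D * D = gf2 tall_gf * D" "D \<noteq> 0"
    using fps_fps_divide_mult[OF D0, of N] DF by (auto simp: mult.commute)
  then have quot: "gf2 tall_gf = N / D"
    by simp
  \<comment> \<open>Three uses of \<open>gf2_Suc\<close> peel off heights 0, 1 and 2 and leave the
    tall posets behind the factor t^3.\<close>
  have "w_gf2 = 1 + (e - 1) * t + (in_x (bip_gf * fps_exp 1) - e) * t ^ 2 + t ^ 3 * gf2 tall_gf"
    unfolding w_gf2_eq t_def e_def
    by (subst gf2_Suc, subst gf2_Suc, subst gf2_Suc)
      (simp add: in_x_hom algebra_simps power2_eq_square power3_eq_cube)
  also have "in_x (bip_gf * fps_exp 1) = in_x (fps_exp (-1)) * P"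
    using arg_cong[OF exp_bip_gf, of in_x] by (simp add: in_x_mult P_def mult.commute)
  finally show "w_gf2 =
      (let e = in_x (fps_exp 1); P = in_x Psi; t = t_var in
        1 + (e - 1) * t + (in_x (fps_exp (-1)) * P - e) * t ^ 2 +
        t ^ 3 *
          ((in_x (fps_exp 3) + in_x (fps_exp 3) * t
             - e * (2 * e + (1 + 2 * e - in_x (fps_exp 2)) * t) * P
             - ((1 - 3 * e + in_x (fps_exp 2)) + (e - 2) * t) * P ^ 2) /
           (e * (e + t * e + t ^ 2)
             + ((1 - 3 * e + in_x (fps_exp 2)) * t + (e - 2) * t ^ 2) * P)))"
    unfolding quot N_def D_def Let_def e_def P_def t_def e2_def e3_def .
next
  define e :: "rat fps" where "e = fps_exp 1"
  define N where "N = 2 * fps_exp 3 + fps_exp 2 * (e - 2) * Psi"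
  define D where "D = e * (2 * e + 1) + (fps_exp 2 - 2 * e - 1) * Psi"
  have D: "D = e\<^sup>2 - e\<^sup>2 * rec_a - e\<^sup>2 * rec_b"
    unfolding D_def e_def rec_a_eq rec_b_eq by (simp add: algebra_simps power2_eq_square)
  have "D * tall_sum = e\<^sup>2 * ((1 - rec_a - rec_b) * tall_sum)"
    unfolding D by (simp add: algebra_simps)
  also have "\<dots> = e\<^sup>2 * tall_gf 0 + e\<^sup>2 * (tall_gf (Suc 0) - rec_a * tall_gf 0)"
    unfolding tall_sum_eq by (simp add: distrib_left)
  \<comment> \<open>\<open>Psi\<close> is added because the theorem writes the contribution e^(-x)
    Psi of the low heights as (e^(-x) - 1) Psi, moving one copy of \<open>Psi\<close> into the
    fraction.\<close>
  finally have "D * (tall_sum + Psi) = N"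
    unfolding distrib_left e_def tall_gf_0 tall_gf_1
    unfolding D_def N_def e_def exp_2 exp_3
    by (simp add: algebra_simps power2_eq_square power3_eq_cube)
  moreover have "fps_nth D 0 = 1"
    by (simp add: D_def e_def Psi_def)
  then have "D \<noteq> 0" by auto
  ultimately have "N / D = tall_sum + Psi"
    by (metis nonzero_mult_div_cancel_left)
  then have "w_gf = (fps_exp (-1) - 1) * Psi + N / D"
    unfolding w_gf_eq exp_bip_gf by (simp add: algebra_simps)
  then show "w_gf =
      (let e = fps_exp 1 in
        (fps_exp (-1) - 1) * Psi +
        (2 * fps_exp 3 + fps_exp 2 * (e - 2) * Psi) /
        (e * (2 * e + 1) + (fps_exp 2 - 2 * e - 1) * Psi))"
    unfolding N_def D_def e_def Let_def .
qed

end
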